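(* For any integers $a\ge 1$, $b\ge 0$ and $c\ge 2$, let $n=a+b+c-1$. Then the chromatic symmetric function of the clique-path-cycle graph $P^b(K_a,C_c)$ satisfies \[ X_{P^b(K_a,\,C_c)}=(a-1)!\sum_{K\vDash n} c_K\, w_K\, e_K, \] where the sum runs over all compositions $K=k_1k_2\dotsm k_\ell$ of $n$ and \[ c_K=\begin{cases} 0, & \text{if } \ell(K)\ge 2 \text{ and } k_2<a,\\[2pt] \displaystyle k_2-a-b+\frac{k_2-k_1}{k_2-1}, & \text{if } k_1\le a-1 \text{ and } k_2\ge a+b,\\[2pt] \Theta_K(a+b), & \text{otherwise} \end{cases} \] (the cases are applied in the order listed). Moreover every coefficient $(a-1)!\,c_K w_K$ is nonnegative; in particular $X_{P^b(K_a,C_c)}$ is $e$-positive.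
   Context: All graphs are finite simple graphs. The chromatic symmetric function of a graph $G$ is $X_G=\sum_{\kappa}\prod_{v\in V(G)}x_{\kappa(v)}$, where $\kappa$ ranges over proper colorings $\kappa:V(G)\to\{1,2,\dots\}$. $e_k$ denotes the $k$-th elementary symmetric function; a symmetric function is $e$-positive if its expansion in the basis $\{e_\lambda\}$ has nonnegative coefficients. $K_a$ is the complete graph on $a$ vertices, $C_c$ is the cycle on $c$ vertices for $c\ge 3$, and $C_2:=K_2$. For rooted graphs $(G,u)$, $(H,v)$ and an integer $k\ge 0$, the path-conjoined graph $P^k(G,H)$ is obtained from the disjoint union of $G$ and $H$ by adding a path of length $k$ (with $k-1$ new internal vertices) joining $u$ and $v$ (for $k=0$, $u$ and $v$ are identified). Cliques and cycles are vertex-transitive, so their root may be any vertex. A composition $K=k_1\dotsm k_\ell$ of $n$ (written $K\vDash n$) is a sequence of positive integers with sum $n$, with length $\ell(K)=\ell$. Define $e_K=e_{k_1}e_{k_2}\dotsm e_{k_\ell}$ and $w_K=k_1(k_2-1)(k_3-1)\dotsm(k_\ell-1)$. For a number $t\le n$, $\sigma_K(t)=\min\{k_1+\dots+k_j: 0\le j\le \ell(K),\ k_1+\dots+k_j\ge t\}$ and $\Theta_K(t)=\sigma_K(t)-t$. *)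

theory Defs
  imports Main "HOL-Library.FuncSet" Complex_Main
begin

text \<open>A formal power series in the commuting variables x_0, x_1, x_2, ... is represented
  by its coefficient function: for an exponent vector alpha (a function nat => nat),
  the value is the coefficient of the monomial prod_i x_i^(alpha i).
  (Exponent vectors of infinite support get coefficient 0 for all series below.)\<close>

type_synonym sf = "(nat \<Rightarrow> nat) \<Rightarrow> real"

text \<open>Chromatic symmetric function of the graph with finite vertex set V and (symmetric,
  irreflexive) edge relation E: coefficient of x^alpha is the number of proper colourings
  kappa : V -> colours with exactly alpha i vertices of colour i.  Colours are indexed by
  nat (a relabelling of the paper's colours 1,2,...).\<close>

definition csf :: "'v set \<Rightarrow> ('v \<Rightarrow> 'v \<Rightarrow> bool) \<Rightarrow> sf" where
  "csf V E \<alpha> = real (card {\<kappa> \<in> V \<rightarrow>\<^sub>E (UNIV :: nat set).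
      (\<forall>u\<in>V. \<forall>v\<in>V. E u v \<longrightarrow> \<kappa> u \<noteq> \<kappa> v) \<and>
      (\<forall>i. card {v\<in>V. \<kappa> v = i} = \<alpha> i)})"

text \<open>e_K = e_{k_1} ... e_{k_l}; e_k is the sum over all k-element sets S of variables of
  prod_{i in S} x_i.  Hence the coefficient of x^alpha in e_K is the number of tuples
  (S_1,...,S_l) of finite sets with |S_j| = k_j such that every index i lies in exactly
  alpha i of the S_j.\<close>

definition ecoef :: "nat list \<Rightarrow> sf" where
  "ecoef K \<alpha> = real (card {Ss :: nat set list. length Ss = length K \<and>
      (\<forall>j<length K. finite (Ss ! j) \<and> card (Ss ! j) = K ! j) \<and>
      (\<forall>i. card {j. j < length K \<and> i \<in> Ss ! j} = \<alpha> i)})"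

definition is_partition :: "nat list \<Rightarrow> bool" where
  "is_partition p \<longleftrightarrow> (\<forall>k\<in>set p. 0 < k) \<and> sorted (rev p)"

definition e_positive :: "sf \<Rightarrow> bool" where
  "e_positive f \<longleftrightarrow> (\<exists>P d. finite P \<and> (\<forall>p\<in>P. is_partition p \<and> 0 \<le> d p) \<and>
      f = (\<lambda>\<alpha>. \<Sum>p\<in>P. d p * ecoef p \<alpha>))"

definition compositions :: "nat \<Rightarrow> nat list set" where
  "compositions n = {K. (\<forall>k\<in>set K. 0 < k) \<and> sum_list K = n}"

definition wK :: "nat list \<Rightarrow> real" where
  "wK K = (case K of [] \<Rightarrow> 1 | k # ks \<Rightarrow> real k * (\<Prod>j\<leftarrow>ks. real j - 1))"

definition sigmaK :: "nat list \<Rightarrow> nat \<Rightarrow> nat" where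
  "sigmaK K t = Min {sum_list (take j K) | j. j \<le> length K \<and> t \<le> sum_list (take j K)}"

definition ThetaK :: "nat list \<Rightarrow> nat \<Rightarrow> real" where
  "ThetaK K t = real (sigmaK K t) - real t"

definition cK :: "nat \<Rightarrow> nat \<Rightarrow> nat list \<Rightarrow> real" where
  "cK a b K =
     (if 2 \<le> length K \<and> K ! 1 < a then 0
      else if 2 \<le> length K \<and> K ! 0 \<le> a - 1 \<and> a + b \<le> K ! 1 then
        real (K ! 1) - real a - real b + (real (K ! 1) - real (K ! 0)) / (real (K ! 1) - 1)
      else ThetaK K (a + b))"

text \<open>Vertices 0, ..., n-1 with n = a+b+c-1.  The clique K_a lives on 0..a-1 with root a-1;
  the path of length b runs a-1, a, ..., a+b-1 (for b = 0 the two roots coincide);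
  the cycle C_c lives on a+b-1, ..., a+b+c-2 = n-1 with root a+b-1
  (edges between consecutive vertices plus the closing edge {a+b-1, n-1};
  for c = 2 this gives the single edge of C_2 = K_2).\<close>

definition cpc_vertices :: "nat \<Rightarrow> nat \<Rightarrow> nat \<Rightarrow> nat set" where
  "cpc_vertices a b c = {0..<a+b+c-1}"

definition clique_edge :: "nat \<Rightarrow> nat \<Rightarrow> nat \<Rightarrow> bool" where
  "clique_edge a u v \<longleftrightarrow> u < a \<and> v < a \<and> u \<noteq> v"

definition path_edge :: "nat \<Rightarrow> nat \<Rightarrow> nat \<Rightarrow> nat \<Rightarrow> bool" where
  "path_edge a b u v \<longleftrightarrow> (\<exists>i. a - 1 \<le> i \<and> i < a + b - 1 \<and> {u, v} = {i, i + 1})"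

definition cycle_edge :: "nat \<Rightarrow> nat \<Rightarrow> nat \<Rightarrow> nat \<Rightarrow> nat \<Rightarrow> bool" where
  "cycle_edge a b c u v \<longleftrightarrow>
     (\<exists>i. a + b - 1 \<le> i \<and> i + 1 < a + b + c - 1 \<and> {u, v} = {i, i + 1}) \<or>
     {u, v} = {a + b - 1, a + b + c - 2}"

definition cpc_edge :: "nat \<Rightarrow> nat \<Rightarrow> nat \<Rightarrow> nat \<Rightarrow> nat \<Rightarrow> bool" where
  "cpc_edge a b c u v \<longleftrightarrow> u \<noteq> v \<and>
     (clique_edge a u v \<or> path_edge a b u v \<or> cycle_edge a b c u v)"

end

(* Restrict to a finite set A of colours and let x_i be the variable of colour i. Put
   E(t) = prod_i (1 + x_i t), E_i(t) = E(t) / (1 + x_i t), D = E - t E', and G = 1 / D, which is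
   the sum over compositions K of prod_j (k_j - 1) e_{k_j}. Walks starting at colour i have
   generating function E_i G; closed walks follow from them by deletion-contraction, giving
   t E_i' G. From G' = - G^2 D' one obtains
     X(P^b(K_a, C_c)) = (c-1) L_n - sum_j X(C_j) L_{n-j},
   where L_m is the lollipop on K_a with m vertices. The identity
     sum_i x_i e_p(A - i) e_q(A - i) = sum_{r <= q} (p + q + 1 - 2 r) e_{p+q+1-r} e_r
   yields L_m = (a-1)! sum_K w_K e_K over the K with length 1 or k_2 >= a. Cutting K into a
   lollipop part and a cycle part, the sum over j telescopes to Theta_K, except that every K with
   k_2 < a and k_1 >= a + b is left with coefficient - k_2 w_K; interchanging k_1 and k_2
   moves these terms to the second case of c_K.
   Coefficients are extracted by letting the x_i be the indeterminates of a polynomial ring. *)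

theory Submission
  imports Defs "HOL-Computational_Algebra.Formal_Power_Series" "HOL-Library.Poly_Mapping"
begin

unbundle fps_syntax

section \<open>Compositions\<close>

lemma compositions_0: "compositions 0 = {[]}"
proof -
  have "K = []" if "\<forall>k\<in>set K. 0 < k" "sum_list K = 0" for K :: "nat list"
    using that by (cases K) auto
  then show ?thesis by (auto simp: compositions_def)
qed

lemma compositions_pos:
  assumes "0 < n"
  shows "compositions n = (\<Union>k\<in>{1..n}. (#) k ` compositions (n - k))"
proof (intro set_eqI iffI)
  fix K assume K: "K \<in> compositions n"
  with assms obtain k K' where "K = k # K'"
    by (cases K) (auto simp: compositions_def)
  with K show "K \<in> (\<Union>k\<in>{1..n}. (#) k ` compositions (n - k))"
    by (auto simp: compositions_def intro!: bexI[of _ k] imageI)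
qed (auto simp: compositions_def)

lemma finite_compositions: "finite (compositions n)"
proof (induction n rule: less_induct)
  case (less n)
  then show ?case
    by (cases "n = 0") (simp_all add: compositions_0 compositions_pos)
qed

lemma sum_compositions_pos:
  assumes "0 < n"
  shows "(\<Sum>K\<in>compositions n. f K) = (\<Sum>k=1..n. \<Sum>K\<in>compositions (n - k). f (k # K))"
proof -
  have "(\<Sum>K\<in>compositions n. f K) = (\<Sum>k\<in>{1..n}. \<Sum>K\<in>(#) k ` compositions (n - k). f K)"
    unfolding compositions_pos[OF assms]
    by (rule sum.UNION_disjoint) (auto simp: finite_compositions)
  also have "\<dots> = (\<Sum>k=1..n. \<Sum>K\<in>compositions (n - k). f (k # K))"
    by (rule sum.cong[OF refl]) (simp add: sum.reindex)
  finally show ?thesis .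
qed

lemma sum_list_take_drop: "sum_list (take r K) + sum_list (drop r K) = sum_list K"
  for K :: "nat list"
  by (metis append_take_drop_id sum_list_append)

text \<open>The pair (K, J) corresponds to \<open>K @ J\<close> cut after \<open>length K\<close>
  parts. Either piece may be empty, hence r runs up to and including
  \<open>length K\<close>.\<close>

lemma sum_compositions_split:
  "(\<Sum>j\<le>n. \<Sum>K\<in>compositions (n - j). \<Sum>J\<in>compositions j. f K J)
    = (\<Sum>K\<in>compositions n. \<Sum>r\<le>length K. f (take r K) (drop r K))"
proof -
  let ?S = "Sigma {..n} (\<lambda>j. compositions (n - j) \<times> compositions j)"
  let ?T = "Sigma (compositions n) (\<lambda>K. {..length K})"
  have "(\<Sum>j\<le>n. \<Sum>K\<in>compositions (n - j). \<Sum>J\<in>compositions j. f K J) = (\<Sum>(j, K, J)\<in>?S. f K J)"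
    by (simp add: sum.Sigma sum.cartesian_product finite_compositions split_def)
  also have "\<dots> = (\<Sum>(K, r)\<in>?T. f (take r K) (drop r K))"
  proof (rule sum.reindex_bij_witness[where i = "\<lambda>(K, r). (sum_list (drop r K), take r K, drop r K)"
          and j = "\<lambda>(j, K, J). (K @ J, length K)"])
    fix b assume "b \<in> ?T"
    then obtain K r where b: "b = (K, r)" "K \<in> compositions n" "r \<le> length K" by auto
    have "sum_list (take r K) + sum_list (drop r K) = n"
      using b by (simp add: sum_list_take_drop compositions_def)
    then show "(case b of (K, r) \<Rightarrow> (sum_list (drop r K), take r K, drop r K)) \<in> ?S"
      using b by (auto simp: compositions_def dest: in_set_takeD in_set_dropD)
  qed (auto simp: compositions_def)
  also have "\<dots> = (\<Sum>K\<in>compositions n. \<Sum>r\<le>length K. f (take r K) (drop r K))"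
    by (simp add: sum.Sigma finite_compositions)
  finally show ?thesis .
qed

section \<open>Generating functions over a commutative ring\<close>

locale weighted_colours =
  fixes A :: "'i set" and x :: "'i \<Rightarrow> 'r::comm_ring_1"
  assumes finite_A [simp]: "finite A"
begin

text \<open>Colour i is dropped by shrinking the index set: \<open>E (A - {i})\<close> stands for
  E(t) / (1 + x_i t), written E_i below, without any division in the ring.\<close>

definition E :: "'i set \<Rightarrow> 'r fps" where
  "E B = (\<Prod>i\<in>B. 1 + fps_const (x i) * fps_X)"

abbreviation e :: "nat \<Rightarrow> 'r" where
  "e k \<equiv> E A $ k"

definition d :: "nat \<Rightarrow> 'r" where
  "d k = (of_nat k - 1) * e k"

definition D :: "'r fps" where
  "D = E A - fps_X * fps_deriv (E A)"

text \<open>The reciprocal of \<open>D\<close> is written out over compositions because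
  \<open>'r\<close> is only a commutative ring; \<open>D_G\<close> confirms that it is the
  reciprocal.\<close>

definition G :: "'r fps" where
  "G = Abs_fps (\<lambda>n. \<Sum>K\<in>compositions n. prod_list (map d K))"

lemma E_nth_0 [simp]: "E B $ 0 = 1"
  unfolding E_def by (induction B rule: infinite_finite_induct) auto

lemma E_remove: "i \<in> A \<Longrightarrow> E A = (1 + fps_const (x i) * fps_X) * E (A - {i})"
  unfolding E_def by (rule prod.remove) auto

lemma e_Suc_remove: "i \<in> A \<Longrightarrow> e (Suc k) = E (A - {i}) $ Suc k + x i * E (A - {i}) $ k"
  by (subst E_remove[of i]) (auto simp: algebra_simps)

lemma E_deriv:
  assumes "finite B"
  shows "fps_deriv (E B) = (\<Sum>i\<in>B. fps_const (x i) * E (B - {i}))"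
  using assms
proof (induction B)
  case (insert i B)
  have "(\<Sum>j\<in>B. fps_const (x j) * E (insert i B - {j}))
      = (1 + fps_const (x i) * fps_X) * (\<Sum>j\<in>B. fps_const (x j) * E (B - {j}))"
    unfolding sum_distrib_left
  proof (intro sum.cong refl)
    fix j assume "j \<in> B"
    with insert have "insert i B - {j} = insert i (B - {j})" "i \<notin> B - {j}" by auto
    with insert(1) show "fps_const (x j) * E (insert i B - {j})
        = (1 + fps_const (x i) * fps_X) * (fps_const (x j) * E (B - {j}))"
      by (simp add: E_def mult_ac)
  qed
  moreover have "E (insert i B) = (1 + fps_const (x i) * fps_X) * E B" "insert i B - {i} = B"
    using insert by (auto simp: E_def)
  ultimately show ?case
    using insert by (simp add: algebra_simps)
qed (simp add: E_def)

lemma sum_remove_nth: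
  assumes "finite B"
  shows "(\<Sum>i\<in>B. x i * E (B - {i}) $ k) = of_nat (Suc k) * E B $ Suc k"
  using arg_cong[OF E_deriv[OF assms], of "\<lambda>f. f $ k"] by (simp add: fps_sum_nth)

lemma D_nth: "D $ k = - d k"
  by (cases k) (auto simp: D_def d_def algebra_simps)

lemma d_0 [simp]: "d 0 = -1"
  by (simp add: d_def)

text \<open>Since \<open>D $ 0\<close> is 1 and \<open>D $ k\<close> is \<open>- d k\<close>, this
  is the recursion of \<open>G\<close> that splits off the first part.\<close>

lemma D_G: "D * G = 1"
proof (rule fps_ext)
  fix n
  show "(D * G) $ n = (1 :: 'r fps) $ n"
  proof (cases "n = 0")
    case False
    have "(D * G) $ n = G $ n - (\<Sum>k=1..n. d k * G $ (n - k))"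
      by (simp add: fps_mult_nth D_nth sum.atLeast_Suc_atMost sum_negf)
    also have "G $ n = (\<Sum>k=1..n. d k * G $ (n - k))"
      using False by (simp add: G_def sum_compositions_pos sum_distrib_left)
    finally show ?thesis using False by simp
  qed (simp add: D_nth G_def compositions_0)
qed

lemma E_G: "E A * G = 1 + fps_X * fps_deriv (E A) * G"
  using D_G by (simp add: D_def algebra_simps)

section \<open>Walks and closed walks\<close>

definition step :: "('i \<Rightarrow> 'r) \<Rightarrow> 'i \<Rightarrow> 'r" where
  "step f i = (\<Sum>j\<in>A - {i}. x j * f j)"

text \<open>Total weight of the l further vertices along a properly coloured path that starts at
  colour i; the weight of the starting vertex is left out.\<close>

definition walks :: "nat \<Rightarrow> 'i \<Rightarrow> 'r" where
  "walks l = (step ^^ l) (\<lambda>_. 1)"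

text \<open>Colourings of a cycle of length \<open>k + 1\<close> through a vertex coloured i, whose own weight is left
  out: a path with k steps whose last colour differs from i.\<close>
primrec closed_walks :: "nat \<Rightarrow> 'i \<Rightarrow> 'r" where
  "closed_walks 0 i = 0"
| "closed_walks (Suc k) i = walks (Suc k) i - x i * closed_walks k i"

text \<open>The coefficient of degree j is the chromatic symmetric function of the cycle C_j.\<close>
definition cyc :: "'r fps" where
  "cyc = - fps_X * fps_deriv D * G"

lemma step_cong: "(\<And>j. j \<in> A \<Longrightarrow> f j = g j) \<Longrightarrow> step f i = step g i"
  by (auto simp: step_def intro!: sum.cong)

text \<open>One more step gives W_{l+1}(i) = sum_j x_j W_l(j) - x_i W_l(i). The first sum has the
  series E' G by the product rule, and E G = 1 + t E' G together with E = (1 + x_i t) E_i closes the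
  induction.\<close>

lemma walks_eq: "i \<in> A \<Longrightarrow> walks l i = (E (A - {i}) * G) $ l"
proof (induction l arbitrary: i)
  case 0
  then show ?case by (simp add: walks_def G_def compositions_0)
next
  case (Suc l)
  have "walks (Suc l) i = step (walks l) i" by (simp add: walks_def)
  also have "\<dots> = (\<Sum>j\<in>A. x j * walks l j) - x i * walks l i"
    using Suc.prems by (simp add: step_def sum.remove)
  also have "(\<Sum>j\<in>A. x j * walks l j) = (fps_deriv (E A) * G) $ l"
    by (simp add: Suc.IH E_deriv sum_distrib_right fps_sum_nth mult.assoc)
  also have "x i * walks l i = (fps_const (x i) * (E (A - {i}) * G)) $ l"
    using Suc by simp
  also have "(fps_deriv (E A) * G) $ l = (E A * G) $ Suc l"
    by (subst E_G) (simp add: mult.assoc)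
  also have "E A * G = E (A - {i}) * G + fps_X * (fps_const (x i) * (E (A - {i}) * G))"
    by (subst E_remove[OF Suc.prems]) (simp add: algebra_simps)
  finally show ?case by simp
qed

lemma D_eq: "i \<in> A \<Longrightarrow>
  D = E (A - {i}) - fps_X * (1 + fps_const (x i) * fps_X) * fps_deriv (E (A - {i}))"
  unfolding D_def by (subst (1 2) E_remove[of i]) (simp_all add: algebra_simps)

text \<open>Multiplying \<open>D_eq\<close> by \<open>G\<close> gives E_i G = 1 + (1 + x_i t) t E_i'
  G. Read coefficientwise, this is the defining recursion of \<open>closed_walks\<close>.\<close>

lemma closed_walks_eq: "i \<in> A \<Longrightarrow> closed_walks k i = (fps_X * fps_deriv (E (A - {i})) * G) $ k"
proof (induction k)
  case (Suc k)
  have "E (A - {i}) * G = D * G + fps_X * fps_deriv (E (A - {i})) * G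
      + fps_X * (fps_const (x i) * (fps_X * fps_deriv (E (A - {i})) * G))"
    by (subst D_eq[OF Suc.prems]) (simp add: algebra_simps)
  then have "walks (Suc k) i = (fps_X * fps_deriv (E (A - {i})) * G) $ Suc k
      + x i * (fps_X * fps_deriv (E (A - {i})) * G) $ k"
    by (simp add: walks_eq Suc.prems D_G fps_mult_left_const_nth del: fps_mult_fps_X_commute)
  then show ?case using Suc by simp
qed (simp add: mult.assoc)

text \<open>Differentiating D G = 1 and multiplying by G replaces the quotient rule.\<close>

lemma deriv_G: "fps_deriv G = - (G * G * fps_deriv D)"
proof -
  have "fps_deriv (D * G) = 0" by (simp add: D_G)
  then have "D * fps_deriv G = - (G * fps_deriv D)"
    by (simp add: algebra_simps eq_neg_iff_add_eq_0)
  then have "G * (D * fps_deriv G) = - (G * G * fps_deriv D)" by (simp add: mult.assoc)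
  moreover have "G * (D * fps_deriv G) = (D * G) * fps_deriv G" by (simp add: mult_ac)
  ultimately show ?thesis by (simp add: D_G)
qed

text \<open>With P = E_i G, the product rule gives t P' = t E_i' G + t E_i G', and
  \<open>deriv_G\<close> turns the last term into \<open>cyc\<close> times P. The factor k comes
  from t d/dt. Closed walks are thereby traded for open walks and a convolution with cycles.\<close>

lemma closed_walks_conv_walks:
  assumes "i \<in> A"
  shows "closed_walks k i = of_nat k * walks k i - (\<Sum>j\<le>k. cyc $ j * walks (k - j) i)"
proof -
  let ?P = "E (A - {i}) * G"
  have "fps_X * fps_deriv (E (A - {i})) * G = fps_X * fps_deriv ?P - cyc * ?P"
    by (simp add: deriv_G cyc_def algebra_simps)
  moreover have "(fps_X * fps_deriv ?P) $ k = of_nat k * ?P $ k"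
    by (cases k) (auto simp del: fps_deriv_mult)
  ultimately show ?thesis
    using assms by (simp add: closed_walks_eq walks_eq fps_mult_nth[of cyc] atMost_atLeast0)
qed

section \<open>The lollipop: a clique with a path\<close>

definition eprod :: "nat list \<Rightarrow> 'r" where
  "eprod K = prod_list (map e K)"

definition wE :: "nat list \<Rightarrow> 'r" where
  "wE K = (case K of [] \<Rightarrow> 1 | k # ks \<Rightarrow> of_nat k * e k * prod_list (map d ks))"

lemma wE_append: "K \<noteq> [] \<Longrightarrow> wE (K @ J) = wE K * prod_list (map d J)"
  by (cases K) (auto simp: wE_def mult.assoc)

text \<open>The summand is \<open>(N - 2r) e\<^sub>N\<^sub>-\<^sub>r e\<^sub>r\<close> with \<open>N = p + q + 1\<close>, split so that both halves can be convolved
  with G.\<close>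
lemma sum_remove_mult:
  "(\<Sum>i\<in>A. x i * E (A - {i}) $ p * E (A - {i}) $ q)
    = (\<Sum>r\<le>q. d (Suc p + q - r) * e r - d r * e (Suc p + q - r))"
proof (induction q arbitrary: p)
  case 0
  show ?case using sum_remove_nth[of A p] by (simp add: d_def algebra_simps)
next
  case (Suc q)
  \<comment> \<open>Each (k+1)-subset of A survives the removal of \<open>card A\<close> - (k+1)
    colours. The terms with \<open>card A\<close> cancel in the antisymmetric combination
    below.\<close>
  have E1: "(\<Sum>i\<in>A. E (A - {i}) $ Suc k) = of_nat (card A) * e (Suc k) - of_nat (Suc k) * e (Suc k)" for k
  proof -
    have "(\<Sum>i\<in>A. E (A - {i}) $ Suc k) = (\<Sum>i\<in>A. e (Suc k) - x i * E (A - {i}) $ k)"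
      by (intro sum.cong refl) (simp add: e_Suc_remove)
    then show ?thesis using sum_remove_nth[of A k] by (simp add: sum_subtractf)
  qed
  \<comment> \<open>The relation e_{k+1} = E_i[k+1] + x_i E_i[k], used for k = p and k = q, moves
    one unit of degree from q to p; hence the induction is over arbitrary p.\<close>
  have "x i * E (A - {i}) $ p * E (A - {i}) $ Suc q
      = e (Suc p) * E (A - {i}) $ Suc q - e (Suc q) * E (A - {i}) $ Suc p
        + x i * E (A - {i}) $ Suc p * E (A - {i}) $ q" if "i \<in> A" for i
    using e_Suc_remove[OF that, of p] e_Suc_remove[OF that, of q] by (simp add: algebra_simps)
  then have "(\<Sum>i\<in>A. x i * E (A - {i}) $ p * E (A - {i}) $ Suc q)
      = e (Suc p) * (\<Sum>i\<in>A. E (A - {i}) $ Suc q) - e (Suc q) * (\<Sum>i\<in>A. E (A - {i}) $ Suc p)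
        + (\<Sum>i\<in>A. x i * E (A - {i}) $ Suc p * E (A - {i}) $ q)"
    by (simp add: sum.distrib sum_subtractf sum_distrib_left)
  then show ?case
    unfolding E1 Suc.IH by (simp add: d_def algebra_simps)
qed

text \<open>Convolving e_r with G is replaced by convolving k e_k, where k is the factor that w_K
  gives to a first part.\<close>

lemma E_G_nth: "(\<Sum>r\<le>m. e r * G $ (m - r)) = of_bool (m = 0) + (\<Sum>k\<le>m. of_nat k * e k * G $ (m - k))"
proof -
  have "(\<Sum>r\<le>m. e r * G $ (m - r)) = (1 + fps_X * fps_deriv (E A) * G) $ m"
    by (simp add: E_G[symmetric] fps_mult_nth atMost_atLeast0)
  moreover have "(fps_X * fps_deriv (E A)) $ k = of_nat k * e k" for k
    by (cases k) auto
  ultimately show ?thesis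
    by (simp add: fps_mult_nth[of "fps_X * fps_deriv (E A)"] atMost_atLeast0)
qed

lemma D_G_nth: "(\<Sum>r\<le>m. d r * G $ (m - r)) = - of_bool (m = 0)"
proof -
  have "- (\<Sum>r\<le>m. d r * G $ (m - r)) = (D * G) $ m"
    by (simp add: fps_mult_nth D_nth atMost_atLeast0 sum_negf)
  also have "\<dots> = of_bool (m = 0)" by (simp add: D_G)
  finally show ?thesis by (metis add.inverse_inverse)
qed

text \<open>These are the compositions that occur for the lollipop; the first case of
  \<open>cK\<close> sends all others to 0.\<close>

definition (in -) admissible :: "nat \<Rightarrow> nat list \<Rightarrow> bool" where
  "admissible a K \<longleftrightarrow> (2 \<le> length K \<longrightarrow> a \<le> K ! 1)"

text \<open>Here K is what follows the first part of a longer composition; its head, when present,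
  is the k_2 = a + h of that composition.\<close>

lemma sum_compositions_hd:
  assumes "1 \<le> a"
  shows "(\<Sum>K\<in>compositions n. of_bool (K \<noteq> [] \<longrightarrow> a \<le> hd K) * prod_list (map d K))
    = of_bool (n = 0) + (\<Sum>h | a + h \<le> n. d (a + h) * G $ (n - a - h))"
proof (cases "n = 0")
  case True
  with assms show ?thesis by (auto simp: compositions_0)
next
  case False
  then have "(\<Sum>K\<in>compositions n. of_bool (K \<noteq> [] \<longrightarrow> a \<le> hd K) * prod_list (map d K))
      = (\<Sum>k=1..n. of_bool (a \<le> k) * (d k * G $ (n - k)))"
    by (simp add: sum_compositions_pos G_def sum_distrib_left mult.left_commute)
  also have "\<dots> = (\<Sum>k | a \<le> k \<and> k \<le> n. d k * G $ (n - k))"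
    using assms by (intro sum.mono_neutral_cong_right) auto
  also have "\<dots> = (\<Sum>h | a + h \<le> n. d (a + h) * G $ (n - a - h))"
    by (rule sum.reindex_bij_witness[of _ "\<lambda>h. a + h" "\<lambda>k. k - a"]) auto
  finally show ?thesis using False by simp
qed

text \<open>The left side is the lollipop series divided by (a - 1)!, with i the colour of the
  clique root. Setting h = q - r in \<open>sum_remove_mult\<close> isolates a part a + h >= a, which
  becomes k_2. \<open>E_G_nth\<close> produces the first part k, and \<open>D_G_nth\<close> removes
  the other half except at the boundary h = l.\<close>

lemma lollipop:
  assumes "1 \<le> a"
  shows "(\<Sum>i\<in>A. x i * E (A - {i}) $ (a - 1) * walks l i)
    = (\<Sum>K\<in>compositions (a + l). of_bool (admissible a K) * wE K)"
proof -
  let ?f = "\<lambda>h r. (d (a + h) * e r - d r * e (a + h)) * G $ (l - h - r)"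
  have "(\<Sum>i\<in>A. x i * E (A - {i}) $ (a - 1) * walks l i)
      = (\<Sum>i\<in>A. \<Sum>q\<le>l. x i * E (A - {i}) $ (a - 1) * E (A - {i}) $ q * G $ (l - q))"
    by (intro sum.cong refl)
       (simp add: walks_eq fps_mult_nth atMost_atLeast0 sum_distrib_left mult.assoc)
  also have "\<dots> = (\<Sum>q\<le>l. (\<Sum>i\<in>A. x i * E (A - {i}) $ (a - 1) * E (A - {i}) $ q) * G $ (l - q))"
    by (subst sum.swap) (simp add: sum_distrib_right)
  also have "\<dots> = (\<Sum>q\<le>l. \<Sum>r\<le>q. ?f (q - r) r)"
    unfolding sum_remove_mult sum_distrib_right using assms
    by (intro sum.cong refl) (simp add: algebra_simps)
  also have "\<dots> = (\<Sum>q\<le>l. \<Sum>h\<le>q. ?f h (q - h))"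
  proof (rule sum.cong[OF refl])
    show "(\<Sum>r\<le>q. ?f (q - r) r) = (\<Sum>h\<le>q. ?f h (q - h))" for q
      by (rule sum.reindex_bij_witness[of _ "\<lambda>h. q - h" "\<lambda>h. q - h"]) auto
  qed
  also have "\<dots> = (\<Sum>(h, r) | h + r \<le> l. ?f h r)"
    by (rule sum.triangle_reindex_eq[symmetric])
  also have "(\<Sum>(h, r) | h + r \<le> l. ?f h r) = (\<Sum>(h, r)\<in>Sigma {..l} (\<lambda>h. {..l - h}). ?f h r)"
    by (intro sum.cong) auto
  also have "\<dots> = (\<Sum>h\<le>l. \<Sum>r\<le>l - h. ?f h r)"
    by (simp add: sum.Sigma)
  also have "\<dots> = (\<Sum>h\<le>l. d (a + h) * (\<Sum>r\<le>l - h. e r * G $ (l - h - r))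
        - e (a + h) * (\<Sum>r\<le>l - h. d r * G $ (l - h - r)))"
    by (intro sum.cong refl) (simp add: sum_distrib_left sum_subtractf algebra_simps)
  \<comment> \<open>At h = l the constant term of E G leaves \<open>d (a + l)\<close> and
    \<open>D_G_nth\<close> leaves \<open>e (a + l)\<close>; together they form the term of the
    one-part composition.\<close>
  also have "\<dots> = (\<Sum>h\<le>l. of_bool (h = l) * (d (a + l) + e (a + l)))
      + (\<Sum>h\<le>l. \<Sum>k\<le>l - h. of_nat k * e k * (d (a + h) * G $ (l - h - k)))"
    unfolding E_G_nth D_G_nth sum.distrib[symmetric]
    by (intro sum.cong refl) (auto simp: sum_distrib_left algebra_simps)
  also have "(\<Sum>h\<le>l. of_bool (h = l) * (d (a + l) + e (a + l))) = of_nat (a + l) * e (a + l)"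
  proof -
    have "(\<Sum>h\<le>l. of_bool (h = l) * (d (a + l) + e (a + l))) = (\<Sum>h\<in>{l}. d (a + l) + e (a + l))"
      by (intro sum.mono_neutral_cong_right) auto
    then show ?thesis by (simp add: d_def algebra_simps)
  qed
  also have "(\<Sum>h\<le>l. \<Sum>k\<le>l - h. of_nat k * e k * (d (a + h) * G $ (l - h - k)))
      = (\<Sum>k=1..a + l. of_nat k * e k * (\<Sum>h | a + h \<le> a + l - k. d (a + h) * G $ (a + l - k - a - h)))"
  proof -
    have "(\<Sum>h\<le>l. \<Sum>k\<le>l - h. of_nat k * e k * (d (a + h) * G $ (l - h - k)))
        = (\<Sum>(h, k)\<in>Sigma {..l} (\<lambda>h. {..l - h}). of_nat k * e k * (d (a + h) * G $ (l - h - k)))"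
      by (simp add: sum.Sigma)
    also have "\<dots> = (\<Sum>(k, h)\<in>Sigma {1..a + l} (\<lambda>k. {h. a + h \<le> a + l - k}).
        of_nat k * e k * (d (a + h) * G $ (a + l - k - a - h)))"
      \<comment> \<open>The witnesses only swap coordinates. Terms with k = 0 occur on the left
        alone and vanish through the factor \<open>of_nat k\<close>.\<close>
      by (rule sum.reindex_bij_witness_not_neutral[where S' = "{..l} \<times> {0}" and T' = "{}"
            and i = "\<lambda>(k, h). (h, k)" and j = "\<lambda>(h, k). (k, h)"])
         (use assms in \<open>auto simp: finite_subset[of _ "{..l}"] algebra_simps\<close>)
    also have "\<dots> = (\<Sum>k=1..a + l. of_nat k * e k * (\<Sum>h | a + h \<le> a + l - k. d (a + h) * G $ (a + l - k - a - h)))"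
      by (subst sum.Sigma[symmetric]) (auto simp: sum_distrib_left intro!: finite_subset[of _ "{..l}"])
    finally show ?thesis .
  qed
  also have "of_nat (a + l) * e (a + l) = (\<Sum>k=1..a + l. of_nat k * e k * of_bool (a + l - k = 0))"
  proof -
    have "(\<Sum>k=1..a + l. of_nat k * e k * of_bool (a + l - k = 0))
       = (\<Sum>k\<in>{a + l}. of_nat k * e k)"
      using assms by (intro sum.mono_neutral_cong_right) auto
    then show ?thesis by simp
  qed
  also have "\<dots> + (\<Sum>k=1..a + l. of_nat k * e k * (\<Sum>h | a + h \<le> a + l - k. d (a + h) * G $ (a + l - k - a - h)))
     = (\<Sum>k=1..a + l. of_nat k * e k *
          (\<Sum>K\<in>compositions (a + l - k). of_bool (K \<noteq> [] \<longrightarrow> a \<le> hd K) * prod_list (map d K)))"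
    by (simp only: sum_compositions_hd[OF assms] sum.distrib distrib_left)
  also have "\<dots> = (\<Sum>k=1..a + l. \<Sum>K\<in>compositions (a + l - k). of_bool (admissible a (k # K)) * wE (k # K))"
  proof (intro sum.cong refl)
    have *: "admissible a (k # K) \<longleftrightarrow> (K \<noteq> [] \<longrightarrow> a \<le> hd K)" for k K
      by (cases K) (auto simp: admissible_def)
    show "of_nat k * e k * (\<Sum>K\<in>compositions (a + l - k). of_bool (K \<noteq> [] \<longrightarrow> a \<le> hd K) * prod_list (map d K))
        = (\<Sum>K\<in>compositions (a + l - k). of_bool (admissible a (k # K)) * wE (k # K))" for k
      unfolding * sum_distrib_left by (intro sum.cong refl) (auto simp: wE_def)
  qed
  also have "\<dots> = (\<Sum>K\<in>compositions (a + l). of_bool (admissible a K) * wE K)"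
    using assms by (subst (2) sum_compositions_pos) auto
  finally show ?thesis .
qed

section \<open>Attaching the cycle\<close>

lemma cyc_nth: "cyc $ j = (\<Sum>J\<in>compositions j. of_bool (J \<noteq> []) * of_nat (hd J) * prod_list (map d J))"
proof (cases "j = 0")
  case True
  then show ?thesis by (simp add: cyc_def compositions_0 mult.assoc)
next
  case False
  \<comment> \<open>So - t D' has coefficients k d_k, and the first part of a cycle composition
    carries the extra factor k.\<close>
  have "(fps_X * fps_deriv D) $ k = - (of_nat k * d k)" for k
    by (cases k) (auto simp: D_nth)
  then have "cyc $ j = (\<Sum>k=0..j. of_nat k * d k * G $ (j - k))"
    unfolding cyc_def by (simp add: fps_mult_nth[of "fps_X * fps_deriv D"] sum_negf)
  also have "\<dots> = (\<Sum>k=1..j. of_nat k * d k * G $ (j - k))"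
    by (simp add: sum.atLeast_Suc_atMost)
  also have "\<dots> = (\<Sum>J\<in>compositions j. of_bool (J \<noteq> []) * of_nat (hd J) * prod_list (map d J))"
    using False by (simp add: sum_compositions_pos G_def sum_distrib_left mult.assoc)
  finally show ?thesis .
qed

text \<open>Coefficient of w_K e_K before compositions are rearranged: c - 1 from the lollipop on
  all n vertices, and for each cut r with an admissible prefix of sum at least a + b the factor
  k_{r+1}, the head of the cycle part. Integer values embed in every commutative ring.\<close>

definition (in -) raw_coeff :: "nat \<Rightarrow> nat \<Rightarrow> nat \<Rightarrow> nat list \<Rightarrow> int" where
  "raw_coeff a b c K = of_bool (admissible a K) * int (c - 1)
     - (\<Sum>r<length K. of_bool (a + b \<le> sum_list (take r K) \<and> admissible a (take r K)) * int (K ! r))"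

lemma step_lin:
  assumes "finite S"
  shows "step (\<lambda>i. u * f i - (\<Sum>j\<in>S. v j * g j i)) i = u * step f i - (\<Sum>j\<in>S. v j * step (g j) i)"
proof -
  have "step (\<lambda>i. u * f i - (\<Sum>j\<in>S. v j * g j i)) i
     = u * step f i - (\<Sum>k\<in>A - {i}. \<Sum>j\<in>S. v j * (x k * g j k))"
    by (simp add: step_def algebra_simps sum_subtractf sum_distrib_left)
  then show ?thesis by (subst (asm) sum.swap) (simp add: step_def sum_distrib_left)
qed

text \<open>Prepending a path is linear. On \<open>closed_walks_conv_walks\<close> it lengthens
  every walk by b and leaves the cycle coefficients alone, as they do not depend on the
  colour.\<close>

lemma step_closed_walks:
  "i \<in> A \<Longrightarrow> (step ^^ b) (closed_walks k) i = of_nat k * walks (b + k) i - (\<Sum>j\<le>k. cyc $ j * walks (b + (k - j)) i)"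
proof (induction b arbitrary: i)
  case (Suc b)
  have "(step ^^ Suc b) (closed_walks k) i
     = step (\<lambda>i. of_nat k * walks (b + k) i - (\<Sum>j\<le>k. cyc $ j * walks (b + (k - j)) i)) i"
    using Suc.IH by (auto intro: step_cong)
  also have "\<dots> = of_nat k * walks (Suc b + k) i - (\<Sum>j\<le>k. cyc $ j * walks (Suc b + (k - j)) i)"
    by (subst step_lin) (simp_all add: walks_def)
  finally show ?case .
qed (simp add: closed_walks_conv_walks)

theorem clique_path_cycle:
  assumes a: "1 \<le> a" and c: "2 \<le> c"
  shows "(\<Sum>i\<in>A. x i * E (A - {i}) $ (a - 1) * (step ^^ b) (closed_walks (c - 1)) i)
    = (\<Sum>K\<in>compositions (a + b + c - 1). of_int (raw_coeff a b c K) * wE K)"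
proof -
  let ?n = "a + b + c - 1"
  let ?L = "\<lambda>n. \<Sum>K\<in>compositions n. of_bool (admissible a K) * wE K"
  let ?H = "\<lambda>J. of_bool (J \<noteq> []) * of_nat (hd J) * prod_list (map d J)"
  let ?w = "\<lambda>i. x i * E (A - {i}) $ (a - 1)"
  have "(\<Sum>i\<in>A. ?w i * (step ^^ b) (closed_walks (c - 1)) i)
     = (\<Sum>i\<in>A. of_nat (c - 1) * (?w i * walks (b + (c - 1)) i)
         - (\<Sum>j\<le>c - 1. cyc $ j * (?w i * walks (b + (c - 1 - j)) i)))"
  proof (rule sum.cong[OF refl])
    fix i assume "i \<in> A"
    show "?w i * (step ^^ b) (closed_walks (c - 1)) i = of_nat (c - 1) * (?w i * walks (b + (c - 1)) i)
         - (\<Sum>j\<le>c - 1. cyc $ j * (?w i * walks (b + (c - 1 - j)) i))"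
      unfolding step_closed_walks[OF \<open>i \<in> A\<close>] right_diff_distrib sum_distrib_left
      by (simp only: mult.left_commute)
  qed
  also have "\<dots> = of_nat (c - 1) * (\<Sum>i\<in>A. ?w i * walks (b + (c - 1)) i)
      - (\<Sum>j\<le>c - 1. cyc $ j * (\<Sum>i\<in>A. ?w i * walks (b + (c - 1 - j)) i))"
    unfolding sum_subtractf sum_distrib_left by (subst (2) sum.swap) (rule refl)
  also have "\<dots> = of_nat (c - 1) * ?L (a + (b + (c - 1)))
      - (\<Sum>j\<le>c - 1. cyc $ j * ?L (a + (b + (c - 1 - j))))"
    unfolding lollipop[OF a] ..
  also have "a + (b + (c - 1)) = ?n" using c by simp
  \<comment> \<open>The bound j <= c - 1 is equivalent to a + b <= n - j, so the range extends to
    all j <= n with an indicator.\<close>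
  also have "(\<Sum>j\<le>c - 1. cyc $ j * ?L (a + (b + (c - 1 - j))))
     = (\<Sum>j\<le>?n. of_bool (a + b \<le> ?n - j) * (cyc $ j * ?L (?n - j)))"
  proof (rule sum.mono_neutral_cong_left)
    fix j assume "j \<in> {..c - 1}"
    then have "a + (b + (c - 1 - j)) = ?n - j" "a + b \<le> ?n - j" using c by auto
    then show "cyc $ j * ?L (a + (b + (c - 1 - j))) = of_bool (a + b \<le> ?n - j) * (cyc $ j * ?L (?n - j))"
      by simp
  qed (use a c in auto)
  also have "\<dots> = (\<Sum>j\<le>?n. \<Sum>K\<in>compositions (?n - j). \<Sum>J\<in>compositions j.
      of_bool (a + b \<le> sum_list K \<and> admissible a K) * wE K * ?H J)"
  proof (intro sum.cong refl)
    fix j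
    have "of_bool (a + b \<le> ?n - j) * (cyc $ j * ?L (?n - j))
       = of_bool (a + b \<le> ?n - j) * (\<Sum>K\<in>compositions (?n - j). \<Sum>J\<in>compositions j.
          of_bool (admissible a K) * wE K * ?H J)"
      unfolding mult.commute[of "cyc $ j"] unfolding cyc_nth sum_product ..
    also have "\<dots> = (\<Sum>K\<in>compositions (?n - j). \<Sum>J\<in>compositions j.
      of_bool (a + b \<le> sum_list K \<and> admissible a K) * wE K * ?H J)"
      unfolding sum_distrib_left by (intro sum.cong refl) (auto simp: compositions_def)
    finally show "of_bool (a + b \<le> ?n - j) * (cyc $ j * ?L (?n - j)) = \<dots>" .
  qed
  also have "\<dots> = (\<Sum>K\<in>compositions ?n. \<Sum>r\<le>length K.
      of_bool (a + b \<le> sum_list (take r K) \<and> admissible a (take r K)) * wE (take r K) * ?H (drop r K))"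
    by (rule sum_compositions_split)
  also have "\<dots> = (\<Sum>K\<in>compositions ?n. \<Sum>r<length K.
      of_bool (a + b \<le> sum_list (take r K) \<and> admissible a (take r K)) * of_nat (K ! r) * wE K)"
  proof (rule sum.cong[OF refl])
    fix K
    \<comment> \<open>\<open>wE_append\<close> needs a nonempty prefix, which a + b >= 1 guarantees.
      The cut at \<open>length K\<close> contributes nothing because its suffix is empty.\<close>
    have "wE (take r K) * prod_list (map d (drop r K)) = wE K"
      if "a + b \<le> sum_list (take r K)" for r
    proof -
      have "take r K \<noteq> []" using that a by (metis add_leE le_zero_eq not_one_le_zero sum_list.Nil)
      then show ?thesis by (metis append_take_drop_id wE_append)
    qed
    then have "of_bool (a + b \<le> sum_list (take r K) \<and> admissible a (take r K)) * wE (take r K) * ?H (drop r K)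
       = of_bool (a + b \<le> sum_list (take r K) \<and> admissible a (take r K)) * of_nat (K ! r) * wE K"
      if "r < length K" for r
      using that by (auto simp: hd_drop_conv_nth mult_ac)
    then show "(\<Sum>r\<le>length K. of_bool (a + b \<le> sum_list (take r K) \<and> admissible a (take r K)) * wE (take r K) * ?H (drop r K))
      = (\<Sum>r<length K. of_bool (a + b \<le> sum_list (take r K) \<and> admissible a (take r K)) * of_nat (K ! r) * wE K)"
      by (intro sum.mono_neutral_cong_right) auto
  qed
  also have "of_nat (c - 1) * ?L ?n - \<dots> = (\<Sum>K\<in>compositions ?n. of_int (raw_coeff a b c K) * wE K)"
  proof -
    have "of_int (raw_coeff a b c K) * wE K = of_nat (c - 1) * (of_bool (admissible a K) * wE K)
        - (\<Sum>r<length K. of_bool (a + b \<le> sum_list (take r K) \<and> admissible a (take r K)) * of_nat (K ! r) * wE K)" for K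
      by (simp add: raw_coeff_def left_diff_distrib sum_distrib_right mult.assoc mult.left_commute
            del: sum_of_bool_mult_eq sum_mult_of_bool_eq)
    then show ?thesis by (simp only: sum_subtractf sum_distrib_left)
  qed
  finally show ?thesis .
qed

end

section \<open>Colourings as words\<close>

definition words :: "'i set \<Rightarrow> nat \<Rightarrow> 'i list set" where
  "words B n = {vs. set vs \<subseteq> B \<and> length vs = n}"

lemma finite_words [simp]: "finite B \<Longrightarrow> finite (words B n)"
  by (simp add: words_def finite_lists_length_eq)

lemma words_0 [simp]: "words B 0 = {[]}"
  by (auto simp: words_def)

lemma sum_words_add:
  "(\<Sum>vs\<in>words B (m + n). f vs) = (\<Sum>us\<in>words B m. \<Sum>vs\<in>words B n. f (us @ vs))"
proof -
  have "(\<Sum>vs\<in>words B (m + n). f vs) = (\<Sum>(us, vs)\<in>words B m \<times> words B n. f (us @ vs))"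
    by (rule sum.reindex_bij_witness[of _ "\<lambda>(us, vs). us @ vs" "\<lambda>vs. (take m vs, drop m vs)"])
       (auto simp: words_def dest: in_set_takeD in_set_dropD)
  then show ?thesis by (simp add: sum.cartesian_product)
qed

lemma sum_words_1: "(\<Sum>vs\<in>words B (Suc 0). f vs) = (\<Sum>j\<in>B. f [j])"
  by (rule sum.reindex_bij_witness[of _ "\<lambda>j. [j]" hd]) (auto simp: words_def length_Suc_conv)

lemma sum_words_Suc:
  "(\<Sum>vs\<in>words B (Suc n). f vs) = (\<Sum>j\<in>B. \<Sum>vs\<in>words B n. f (j # vs))"
  using sum_words_add[of f B 1 n] by (simp add: sum_words_1)

lemma sum_words_snoc:
  "(\<Sum>vs\<in>words B (Suc n). f vs) = (\<Sum>us\<in>words B n. \<Sum>j\<in>B. f (us @ [j]))"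
  using sum_words_add[of f B n 1] by (simp add: sum_words_1)

context weighted_colours
begin

definition wt :: "'i list \<Rightarrow> 'r" where
  "wt vs = prod_list (map x vs)"

lemma wt_simps [simp]: "wt [] = 1" "wt (i # vs) = x i * wt vs" "wt (us @ vs) = wt us * wt vs"
  by (auto simp: wt_def)

text \<open>Choosing the first colour j leaves k distinct colours from B - {j};
  \<open>sum_remove_nth\<close> then supplies the factor k + 1 of the factorial.\<close>

lemma sum_distinct_words:
  "finite B \<Longrightarrow> (\<Sum>us\<in>words B k. of_bool (distinct us) * wt us) = of_nat (fact k) * E B $ k"
proof (induction k arbitrary: B)
  case (Suc k)
  have "(\<Sum>us\<in>words B (Suc k). of_bool (distinct us) * wt us)
      = (\<Sum>j\<in>B. x j * (\<Sum>us\<in>words (B - {j}) k. of_bool (distinct us) * wt us))"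
    unfolding sum_words_Suc
  proof (rule sum.cong[OF refl])
    fix j
    have "(\<Sum>us\<in>words B k. of_bool (distinct (j # us)) * wt (j # us))
       = (\<Sum>us\<in>words (B - {j}) k. x j * (of_bool (distinct us) * wt us))"
      using Suc.prems by (intro sum.mono_neutral_cong_right) (auto simp: words_def finite_lists_length_eq)
    then show "(\<Sum>us\<in>words B k. of_bool (distinct (j # us)) * wt (j # us))
       = x j * (\<Sum>us\<in>words (B - {j}) k. of_bool (distinct us) * wt us)"
      by (simp only: sum_distrib_left)
  qed
  also have "\<dots> = of_nat (fact k) * (\<Sum>j\<in>B. x j * E (B - {j}) $ k)"
    using Suc by (simp add: sum_distrib_left mult_ac)
  also have "\<dots> = of_nat (fact (Suc k)) * E B $ Suc k"
    using Suc.prems by (simp add: sum_remove_nth algebra_simps)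
  finally show ?case .
qed simp

lemma sum_walks: "(\<Sum>vs\<in>words A l. of_bool (successively (\<noteq>) (i # vs)) * wt vs) = walks l i"
proof (induction l arbitrary: i)
  case (Suc l)
  have "(\<Sum>vs\<in>words A (Suc l). of_bool (successively (\<noteq>) (i # vs)) * wt vs)
     = (\<Sum>j\<in>A. of_bool (i \<noteq> j) * (x j * (\<Sum>vs\<in>words A l. of_bool (successively (\<noteq>) (j # vs)) * wt vs)))"
    unfolding sum_words_Suc sum_distrib_left by (intro sum.cong refl) auto
  also have "\<dots> = step (walks l) i"
    unfolding step_def Suc.IH by (intro sum.mono_neutral_cong_right) auto
  finally show ?case by (simp add: walks_def)
qed (simp add: walks_def)

text \<open>Deletion-contraction at the closing edge: words ending in i are subtracted, and dropping
  that last letter, of weight x_i, leaves a closed walk that is one shorter.\<close>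

lemma sum_closed_walks:
  "i \<in> A \<Longrightarrow> (\<Sum>vs\<in>words A k. of_bool (successively (\<noteq>) (i # vs) \<and> last (i # vs) \<noteq> i) * wt vs) = closed_walks k i"
proof (induction k)
  case (Suc k)
  let ?S = "\<lambda>vs. successively (\<noteq>) (i # vs)"
  have "(\<Sum>vs\<in>words A (Suc k). of_bool (?S vs \<and> last (i # vs) \<noteq> i) * wt vs)
     = walks (Suc k) i - (\<Sum>vs\<in>words A (Suc k). of_bool (?S vs \<and> last (i # vs) = i) * wt vs)"
    unfolding sum_walks[symmetric] sum_subtractf[symmetric] by (intro sum.cong refl) auto
  also have "(\<Sum>vs\<in>words A (Suc k). of_bool (?S vs \<and> last (i # vs) = i) * wt vs)
      = (\<Sum>us\<in>words A k. x i * (of_bool (?S us \<and> last (i # us) \<noteq> i) * wt us))"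
    unfolding sum_words_snoc
  proof (rule sum.cong[OF refl])
    fix us
    have S: "?S (us @ [i]) \<longleftrightarrow> ?S us \<and> last (i # us) \<noteq> i"
      using successively_append_iff[of "(\<noteq>)" "i # us" "[i]"] by simp
    have "(\<Sum>j\<in>A. of_bool (?S (us @ [j]) \<and> last (i # us @ [j]) = i) * wt (us @ [j]))
       = (\<Sum>j\<in>{i}. of_bool (?S (us @ [i])) * wt (us @ [i]))"
      using Suc.prems by (intro sum.mono_neutral_cong_right) auto
    then show "(\<Sum>j\<in>A. of_bool (?S (us @ [j]) \<and> last (i # us @ [j]) = i) * wt (us @ [j]))
      = x i * (of_bool (?S us \<and> last (i # us) \<noteq> i) * wt us)"
      unfolding S by (simp add: mult_ac)
  qed
  also have "\<dots> = x i * closed_walks k i"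
    using Suc by (simp only: sum_distrib_left[symmetric])
  finally show ?case by simp
qed simp

text \<open>The closing edge joins entry b to the last entry; each letter in front of entry b is
  peeled off as one application of \<open>step\<close>.\<close>

lemma sum_path_cycle:
  "i \<in> A \<Longrightarrow> (\<Sum>vs\<in>words A (b + k). of_bool (successively (\<noteq>) (i # vs) \<and> last (i # vs) \<noteq> (i # vs) ! b) * wt vs)
    = (step ^^ b) (closed_walks k) i"
proof (induction b arbitrary: i)
  case 0
  then show ?case using sum_closed_walks[of i k] by simp
next
  case (Suc b)
  have "(\<Sum>vs\<in>words A (Suc b + k). of_bool (successively (\<noteq>) (i # vs) \<and> last (i # vs) \<noteq> (i # vs) ! Suc b) * wt vs)
     = (\<Sum>j\<in>A. of_bool (i \<noteq> j) * (x j * (\<Sum>vs\<in>words A (b + k).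
        of_bool (successively (\<noteq>) (j # vs) \<and> last (j # vs) \<noteq> (j # vs) ! b) * wt vs)))"
    unfolding add_Suc sum_words_Suc sum_distrib_left by (intro sum.cong refl) auto
  also have "\<dots> = (\<Sum>j\<in>A. of_bool (i \<noteq> j) * (x j * (step ^^ b) (closed_walks k) j))"
    using Suc.IH by simp
  also have "\<dots> = step ((step ^^ b) (closed_walks k)) i"
    unfolding step_def by (intro sum.mono_neutral_cong_right) auto
  finally show ?case by simp
qed

text \<open>Entry a - 1 is the clique root and entry a + b - 1 the cycle root. The path edges and
  all cycle edges but the closing one are consecutive, so one \<open>successively\<close> covers
  both.\<close>

definition (in -) proper_word :: "nat \<Rightarrow> nat \<Rightarrow> 'i list \<Rightarrow> bool" where
  "proper_word a b xs \<longleftrightarrow> distinct (take a xs) \<and> successively (\<noteq>) (drop (a - 1) xs)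
     \<and> last xs \<noteq> xs ! (a + b - 1)"

text \<open>A word is cut as \<open>us @ i # vs\<close> at the clique root. Once its colour i is
  fixed, the two sides are independent: \<open>us\<close> yields (a - 1)! E_i[a-1], and
  \<open>vs\<close> yields the path with the cycle.\<close>

lemma sum_proper_words:
  assumes "1 \<le> a" "2 \<le> c"
  shows "(\<Sum>xs\<in>words A (a + b + c - 1). of_bool (proper_word a b xs) * wt xs)
    = of_nat (fact (a - 1)) * (\<Sum>K\<in>compositions (a + b + c - 1). of_int (raw_coeff a b c K) * wE K)"
proof -
  let ?Q = "\<lambda>i vs. successively (\<noteq>) (i # vs) \<and> last (i # vs) \<noteq> (i # vs) ! b"
  have n: "a + b + c - 1 = (a - 1) + Suc (b + (c - 1))" using assms by simp
  have "(\<Sum>xs\<in>words A (a + b + c - 1). of_bool (proper_word a b xs) * wt xs)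
     = (\<Sum>us\<in>words A (a - 1). \<Sum>i\<in>A. \<Sum>vs\<in>words A (b + (c - 1)).
         of_bool (proper_word a b (us @ i # vs)) * wt (us @ i # vs))"
    unfolding n sum_words_add sum_words_Suc ..
  also have "\<dots> = (\<Sum>us\<in>words A (a - 1). \<Sum>i\<in>A. \<Sum>vs\<in>words A (b + (c - 1)).
         x i * (of_bool (distinct us \<and> i \<notin> set us) * wt us) * (of_bool (?Q i vs) * wt vs))"
  proof (intro sum.cong refl)
    fix us i vs assume "us \<in> words A (a - 1)"
    then have us: "length us = a - 1" by (simp add: words_def)
    then have "proper_word a b (us @ i # vs) \<longleftrightarrow> (distinct us \<and> i \<notin> set us) \<and> ?Q i vs"
      using assms by (auto simp: proper_word_def take_Cons' nth_append nth_Cons')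
    then show "of_bool (proper_word a b (us @ i # vs)) * wt (us @ i # vs)
       = x i * (of_bool (distinct us \<and> i \<notin> set us) * wt us) * (of_bool (?Q i vs) * wt vs)"
      by (simp add: of_bool_conj mult_ac)
  qed
  also have "\<dots> = (\<Sum>us\<in>words A (a - 1). \<Sum>i\<in>A.
         x i * (of_bool (distinct us \<and> i \<notin> set us) * wt us) * (step ^^ b) (closed_walks (c - 1)) i)"
    by (intro sum.cong refl) (simp only: sum_distrib_left[symmetric] sum_path_cycle)
  also have "\<dots> = (\<Sum>i\<in>A. x i * (\<Sum>us\<in>words A (a - 1). of_bool (distinct us \<and> i \<notin> set us) * wt us)
        * (step ^^ b) (closed_walks (c - 1)) i)"
    unfolding sum_distrib_left sum_distrib_right by (rule sum.swap)
  also have "\<dots> = (\<Sum>i\<in>A. x i * (of_nat (fact (a - 1)) * E (A - {i}) $ (a - 1)) * (step ^^ b) (closed_walks (c - 1)) i)"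
  proof (rule sum.cong[OF refl])
    fix i
    have "(\<Sum>us\<in>words A (a - 1). of_bool (distinct us \<and> i \<notin> set us) * wt us)
       = (\<Sum>us\<in>words (A - {i}) (a - 1). of_bool (distinct us) * wt us)"
      by (intro sum.mono_neutral_cong_right) (auto simp: words_def finite_lists_length_eq)
    then show "x i * (\<Sum>us\<in>words A (a - 1). of_bool (distinct us \<and> i \<notin> set us) * wt us) * (step ^^ b) (closed_walks (c - 1)) i
       = x i * (of_nat (fact (a - 1)) * E (A - {i}) $ (a - 1)) * (step ^^ b) (closed_walks (c - 1)) i"
      by (simp only: sum_distinct_words finite_Diff finite_A)
  qed
  also have "\<dots> = of_nat (fact (a - 1)) * (\<Sum>i\<in>A. x i * E (A - {i}) $ (a - 1) * (step ^^ b) (closed_walks (c - 1)) i)"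
    unfolding sum_distrib_left by (intro sum.cong refl) (simp only: mult_ac)
  finally show ?thesis using clique_path_cycle[OF assms] by simp
qed

end

section \<open>Expansion of e_K over tuples of sets\<close>

context weighted_colours
begin

lemma prod_fps_const: "(\<Prod>i\<in>S. fps_const (x i)) = fps_const (\<Prod>i\<in>S. x i)"
  by (induction S rule: infinite_finite_induct) auto

lemma E_nth: "finite B \<Longrightarrow> E B $ k = (\<Sum>S | S \<subseteq> B \<and> card S = k. \<Prod>i\<in>S. x i)"
proof -
  assume B: "finite B"
  have "E B = (\<Prod>i\<in>B. fps_const (x i) * fps_X + 1)"
    by (simp add: E_def add.commute)
  also have "\<dots> = (\<Sum>S\<in>Pow B. fps_const (\<Prod>i\<in>S. x i) * fps_X ^ card S)"
    by (subst prod_add[OF B]) (simp add: prod.distrib prod_fps_const)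
  finally have "E B $ k = (\<Sum>S\<in>Pow B. (\<Prod>i\<in>S. x i) * of_bool (card S = k))"
    by (auto simp: fps_sum_nth intro!: sum.cong)
  also have "\<dots> = (\<Sum>S | S \<subseteq> B \<and> card S = k. \<Prod>i\<in>S. x i)"
    using B by (intro sum.mono_neutral_cong_right) auto
  finally show ?thesis .
qed

text \<open>Finiteness is recorded alongside because \<open>lookup_sum_monom\<close> extracts
  coefficients only over a finite index set.\<close>

lemma eprod_eq:
  "eprod K = (\<Sum>Ss | list_all2 (\<lambda>S k. S \<subseteq> A \<and> card S = k) Ss K. \<Prod>S\<leftarrow>Ss. \<Prod>i\<in>S. x i)"
  and finite_tuples: "finite {Ss. list_all2 (\<lambda>S k. S \<subseteq> A \<and> card S = k) Ss K}"
proof (induction K)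
  case Nil
  have "{Ss. list_all2 (\<lambda>S k. S \<subseteq> A \<and> card S = k) Ss []} = {[]}" by auto
  then show "eprod [] = (\<Sum>Ss | list_all2 (\<lambda>S k. S \<subseteq> A \<and> card S = k) Ss []. \<Prod>S\<leftarrow>Ss. \<Prod>i\<in>S. x i)"
    and "finite {Ss. list_all2 (\<lambda>S k. S \<subseteq> A \<and> card S = k) Ss []}"
    by (simp_all add: eprod_def)
next
  case (Cons k K)
  let ?T = "\<lambda>K. {Ss. list_all2 (\<lambda>S k. S \<subseteq> A \<and> card S = k) Ss K}"
  have T: "?T (k # K) = (\<lambda>(S, Ss). S # Ss) ` ({S. S \<subseteq> A \<and> card S = k} \<times> ?T K)"
    by (auto simp: list_all2_Cons2)
  then show "finite (?T (k # K))" using Cons by simp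
  have "eprod (k # K) = (\<Sum>(S, Ss)\<in>{S. S \<subseteq> A \<and> card S = k} \<times> ?T K. (\<Prod>i\<in>S. x i) * (\<Prod>S\<leftarrow>Ss. \<Prod>i\<in>S. x i))"
    using Cons(1) by (simp add: eprod_def E_nth sum_product sum.cartesian_product)
  also have "\<dots> = (\<Sum>Ss\<in>?T (k # K). \<Prod>S\<leftarrow>Ss. \<Prod>i\<in>S. x i)"
    unfolding T by (subst sum.reindex) (auto simp: inj_on_def intro!: sum.cong)
  finally show "eprod (k # K) = (\<Sum>Ss\<in>?T (k # K). \<Prod>S\<leftarrow>Ss. \<Prod>i\<in>S. x i)" .
qed

text \<open>The weight w_K is an integer, so it acts on \<open>'r\<close> as a scalar and can later
  be pulled out of \<open>lookup\<close>.\<close>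

lemma wE_eprod:
  "wE K = of_int (case K of [] \<Rightarrow> 1 | k # ks \<Rightarrow> int k * (\<Prod>j\<leftarrow>ks. int j - 1)) * eprod K"
proof -
  have "prod_list (map d ks) = of_int (\<Prod>j\<leftarrow>ks. int j - 1) * prod_list (map e ks)" for ks
    by (induction ks) (auto simp: d_def mult_ac)
  then show ?thesis by (cases K) (auto simp: wE_def eprod_def mult_ac)
qed

end

lemma wK_of_int:
  "wK K = real_of_int (case K of [] \<Rightarrow> 1 | k # ks \<Rightarrow> int k * (\<Prod>j\<leftarrow>ks. int j - 1))"
proof -
  have "(\<Prod>j\<leftarrow>ks. real j - 1) = real_of_int (\<Prod>j\<leftarrow>ks. int j - 1)" for ks
    by (induction ks) auto
  then show ?thesis by (cases K) (auto simp: wK_def)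
qed

section \<open>Coefficients in the polynomial ring\<close>

abbreviation monom :: "('i \<Rightarrow>\<^sub>0 nat) \<Rightarrow> (('i \<Rightarrow>\<^sub>0 nat) \<Rightarrow>\<^sub>0 real)" where
  "monom m \<equiv> Poly_Mapping.single m 1"

abbreviation indet :: "'i \<Rightarrow> (('i \<Rightarrow>\<^sub>0 nat) \<Rightarrow>\<^sub>0 real)" where
  "indet i \<equiv> monom (Poly_Mapping.single i (Suc 0))"

lemma lookup_const_mult:
  "Poly_Mapping.lookup (Poly_Mapping.single 0 s * p) m = s * Poly_Mapping.lookup p m"
  for p :: "('i \<Rightarrow>\<^sub>0 nat) \<Rightarrow>\<^sub>0 real"
  by (simp add: mult_map_scale_conv_mult[symmetric] Poly_Mapping.map.rep_eq when_def)

lemma lookup_of_int_mult: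
  "Poly_Mapping.lookup (of_int l * p) m = of_int l * Poly_Mapping.lookup p m"
  for p :: "('i \<Rightarrow>\<^sub>0 nat) \<Rightarrow>\<^sub>0 real"
  using lookup_const_mult[of "of_int l" p m] by simp

lemma lookup_of_nat_mult:
  "Poly_Mapping.lookup (of_nat l * p) m = of_nat l * Poly_Mapping.lookup p m"
  for p :: "('i \<Rightarrow>\<^sub>0 nat) \<Rightarrow>\<^sub>0 real"
  using lookup_const_mult[of "of_nat l" p m] by simp

text \<open>This turns coefficients into cardinalities, the form in which \<open>csf\<close> and
  \<open>ecoef\<close> are defined.\<close>

lemma lookup_sum_monom:
  assumes "finite S"
  shows "Poly_Mapping.lookup (\<Sum>s\<in>S. of_bool (P s) * monom (f s)) m = real (card {s\<in>S. P s \<and> f s = m})"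
proof -
  have "Poly_Mapping.lookup (\<Sum>s\<in>S. of_bool (P s) * monom (f s)) m
      = (\<Sum>s\<in>S. if P s \<and> f s = m then 1 else 0)"
    unfolding lookup_sum by (intro sum.cong) (auto simp: lookup_single when_def)
  then show ?thesis using assms by (simp add: sum.If_cases Int_def)
qed

lemma prod_list_monom: "(\<Prod>s\<leftarrow>ss. monom (f s)) = monom (\<Sum>s\<leftarrow>ss. f s)"
  by (induction ss) (simp_all add: mult_single)

lemma prod_monom: "(\<Prod>s\<in>S. monom (f s)) = monom (\<Sum>s\<in>S. f s)"
  by (induction S rule: infinite_finite_induct) (simp_all add: mult_single)

lemma lookup_sum_list_single: "Poly_Mapping.lookup (\<Sum>i\<leftarrow>vs. Poly_Mapping.single i (Suc 0)) j = count_list vs j"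
  by (induction vs) (auto simp: lookup_add lookup_single when_def)

lemma lookup_sum_list_sum_single:
  "(\<And>S. S \<in> set Ss \<Longrightarrow> finite S) \<Longrightarrow>
   Poly_Mapping.lookup (\<Sum>S\<leftarrow>Ss. \<Sum>i\<in>S. Poly_Mapping.single i (Suc 0)) j = card {k. k < length Ss \<and> j \<in> Ss ! k}"
proof -
  assume "\<And>S. S \<in> set Ss \<Longrightarrow> finite S"
  then have "Poly_Mapping.lookup (\<Sum>S\<leftarrow>Ss. \<Sum>i\<in>S. Poly_Mapping.single i (Suc 0)) j = length (filter (\<lambda>S. j \<in> S) Ss)"
    by (induction Ss) (auto simp: lookup_add lookup_sum lookup_single when_def)
  then show ?thesis by (simp add: length_filter_conv_card)
qed

text \<open>A tuple counted by \<open>ecoef\<close> uses only indices in the support of m, hence in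
  A, so restricting to the finitely many variables of A loses nothing.\<close>

lemma ecoef_lookup:
  assumes "finite A" "\<And>i. Poly_Mapping.lookup m i \<noteq> 0 \<Longrightarrow> i \<in> A"
  shows "ecoef K (Poly_Mapping.lookup m) = Poly_Mapping.lookup (weighted_colours.eprod A indet K) m"
proof -
  interpret weighted_colours A indet by unfold_locales fact
  let ?T = "{Ss. list_all2 (\<lambda>S k. S \<subseteq> A \<and> card S = k) Ss K}"
  have "eprod K = (\<Sum>Ss\<in>?T. of_bool True * monom (\<Sum>S\<leftarrow>Ss. \<Sum>i\<in>S. Poly_Mapping.single i (Suc 0)))"
    by (simp add: eprod_eq prod_monom prod_list_monom)
  then have "Poly_Mapping.lookup (eprod K) m
      = real (card {Ss\<in>?T. (\<Sum>S\<leftarrow>Ss. \<Sum>i\<in>S. Poly_Mapping.single i (Suc 0)) = m})"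
    by (simp only: lookup_sum_monom[OF finite_tuples] simp_thms)
  also have "{Ss\<in>?T. (\<Sum>S\<leftarrow>Ss. \<Sum>i\<in>S. Poly_Mapping.single i (Suc 0)) = m}
     = {Ss. length Ss = length K \<and>
      (\<forall>j<length K. finite (Ss ! j) \<and> card (Ss ! j) = K ! j) \<and>
      (\<forall>i. card {j. j < length K \<and> i \<in> Ss ! j} = Poly_Mapping.lookup m i)}" (is "?L = ?R")
  proof (intro set_eqI iffI)
    fix Ss assume Ss: "Ss \<in> ?L"
    then have "\<And>S. S \<in> set Ss \<Longrightarrow> finite S"
      using finite_subset[OF _ finite_A] by (auto simp: list_all2_conv_all_nth in_set_conv_nth)
    with Ss show "Ss \<in> ?R"
      using finite_subset[OF _ finite_A]
      by (auto simp: list_all2_conv_all_nth lookup_sum_list_sum_single)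
  next
    fix Ss assume Ss: "Ss \<in> ?R"
    have "Ss ! j \<subseteq> A" if j: "j < length K" for j
    proof
      fix i assume "i \<in> Ss ! j"
      with j have "card {j. j < length K \<and> i \<in> Ss ! j} \<noteq> 0" by auto
      with Ss show "i \<in> A" using assms(2) by auto
    qed
    moreover have "\<And>S. S \<in> set Ss \<Longrightarrow> finite S"
      using Ss by (auto simp: in_set_conv_nth)
    ultimately show "Ss \<in> ?L"
      using Ss by (auto simp: list_all2_conv_all_nth lookup_sum_list_sum_single intro!: poly_mapping_eqI)
  qed
  finally show ?thesis by (simp add: ecoef_def)
qed

section \<open>Graph colourings and words\<close>

lemma proper_word_iff:
  assumes "1 \<le> a" "2 \<le> c" "length xs = a + b + c - 1"
  shows "proper_word a b xs \<longleftrightarrow>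
    (\<forall>u\<in>cpc_vertices a b c. \<forall>v\<in>cpc_vertices a b c. cpc_edge a b c u v \<longrightarrow> xs ! u \<noteq> xs ! v)"
    (is "_ \<longleftrightarrow> ?R")
proof
  assume P: "proper_word a b xs"
  have clique: "xs ! u \<noteq> xs ! v" if "u < a" "v < a" "u \<noteq> v" for u v
  proof -
    have "distinct (take a xs)" using P by (simp add: proper_word_def)
    then have "take a xs ! u \<noteq> take a xs ! v"
      using that assms by (subst nth_eq_iff_index_eq) auto
    then show ?thesis using that by simp
  qed
  have path: "xs ! i \<noteq> xs ! Suc i" if "a - 1 \<le> i" "Suc i < length xs" for i
  proof -
    have "successively (\<noteq>) (drop (a - 1) xs)" using P by (simp add: proper_word_def)
    moreover have "Suc (i - (a - 1)) < length (drop (a - 1) xs)" using that by simp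
    ultimately have "drop (a - 1) xs ! (i - (a - 1)) \<noteq> drop (a - 1) xs ! Suc (i - (a - 1))"
      unfolding successively_conv_nth by blast
    moreover have "a - 1 + (i - (a - 1)) = i" "a - 1 + Suc (i - (a - 1)) = Suc i"
      using that by simp_all
    ultimately show ?thesis using that by (simp add: nth_drop)
  qed
  have close: "xs ! (a + b - 1) \<noteq> xs ! (a + b + c - 2)"
  proof -
    have "last xs = xs ! (length xs - 1)" using assms by (intro last_conv_nth) auto
    moreover have "length xs - 1 = a + b + c - 2" using assms by simp
    ultimately show ?thesis using P by (metis proper_word_def)
  qed
  show ?R
  proof (intro ballI impI)
    fix u v assume "cpc_edge a b c u v"
    then consider "u < a" "v < a" "u \<noteq> v"
      | i where "a - 1 \<le> i" "i < a + b - 1" "{u, v} = {i, i + 1}"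
      | i where "a + b - 1 \<le> i" "i + 1 < a + b + c - 1" "{u, v} = {i, i + 1}"
      | "{u, v} = {a + b - 1, a + b + c - 2}"
      unfolding cpc_edge_def clique_edge_def path_edge_def cycle_edge_def by metis
    then show "xs ! u \<noteq> xs ! v"
    proof cases
      case 1
      then show ?thesis by (rule clique)
    next
      case (2 i)
      then have "xs ! i \<noteq> xs ! Suc i" using assms by (intro path) linarith+
      with 2(3) show ?thesis by (auto simp: doubleton_eq_iff)
    next
      case (3 i)
      then have "xs ! i \<noteq> xs ! Suc i" using assms by (intro path) linarith+
      with 3(3) show ?thesis by (auto simp: doubleton_eq_iff)
    next
      case 4
      with close show ?thesis by (metis doubleton_eq_iff)
    qed
  qed
next
  assume R: ?R
  have "distinct (take a xs)"
  proof -
    have "xs ! u \<noteq> xs ! v" if "u < a" "v < a" "u \<noteq> v" for u v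
      using R that assms by (auto simp: cpc_vertices_def cpc_edge_def clique_edge_def)
    then show ?thesis by (auto simp: distinct_conv_nth)
  qed
  moreover have "successively (\<noteq>) (drop (a - 1) xs)"
    unfolding successively_conv_nth
  proof (intro allI impI)
    fix i assume "Suc i < length (drop (a - 1) xs)"
    then have i: "a - 1 + i + 1 < a + b + c - 1" using assms by simp
    have "cpc_edge a b c (a - 1 + i) (a - 1 + i + 1)"
    \<comment> \<open>The first b consecutive edges after the clique root belong to the path, the
      later ones to the cycle.\<close>
    proof (cases "i < b")
      case True
      then have "path_edge a b (a - 1 + i) (a - 1 + i + 1)"
        unfolding path_edge_def using assms by (intro exI[of _ "a - 1 + i"]) auto
      then show ?thesis by (simp add: cpc_edge_def)
    next
      case False
      then have "cycle_edge a b c (a - 1 + i) (a - 1 + i + 1)"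
        unfolding cycle_edge_def using assms i by (intro disjI1 exI[of _ "a - 1 + i"]) auto
      then show ?thesis by (simp add: cpc_edge_def)
    qed
    then have "xs ! (a - 1 + i) \<noteq> xs ! (a - 1 + i + 1)"
      using R i by (auto simp: cpc_vertices_def)
    then show "drop (a - 1) xs ! i \<noteq> drop (a - 1) xs ! Suc i"
      using i assms by simp
  qed
  moreover have "last xs \<noteq> xs ! (a + b - 1)"
  proof -
    have "cpc_edge a b c (a + b - 1) (a + b + c - 2)"
      using assms by (auto simp: cpc_edge_def cycle_edge_def)
    then have "xs ! (a + b - 1) \<noteq> xs ! (a + b + c - 2)"
      using R assms by (auto simp: cpc_vertices_def)
    moreover have "last xs = xs ! (length xs - 1)" using assms by (intro last_conv_nth) auto
    moreover have "length xs - 1 = a + b + c - 2" using assms by simp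
    ultimately show ?thesis by metis
  qed
  ultimately show "proper_word a b xs" by (simp add: proper_word_def)
qed

text \<open>A colouring is listed by the colours of the vertices 0, ..., n - 1. Colour counts
  \<alpha> exclude every colour outside A, so the infinite palette shrinks to A.\<close>

lemma csf_words:
  assumes "1 \<le> a" "2 \<le> c" "\<And>i. \<alpha> i \<noteq> 0 \<Longrightarrow> i \<in> A"
  shows "csf (cpc_vertices a b c) (cpc_edge a b c) \<alpha>
    = real (card {xs\<in>words A (a + b + c - 1). proper_word a b xs \<and> count_list xs = \<alpha>})"
proof -
  let ?n = "a + b + c - 1"
  let ?V = "cpc_vertices a b c"
  let ?L = "{\<kappa> \<in> ?V \<rightarrow>\<^sub>E (UNIV :: nat set).
      (\<forall>u\<in>?V. \<forall>v\<in>?V. cpc_edge a b c u v \<longrightarrow> \<kappa> u \<noteq> \<kappa> v) \<and> (\<forall>i. card {v\<in>?V. \<kappa> v = i} = \<alpha> i)}"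
  let ?R = "{xs\<in>words A ?n. proper_word a b xs \<and> count_list xs = \<alpha>}"
  have V: "?V = {..<?n}" by (auto simp: cpc_vertices_def)
  have count: "count_list xs i = card {v\<in>?V. xs ! v = i}" if "length xs = ?n" for xs :: "nat list" and i
    using that by (simp add: count_list_eq_length_filter length_filter_conv_card V eq_commute lessThan_def)
  have "bij_betw (\<lambda>\<kappa>. map \<kappa> [0..<?n]) ?L ?R"
  proof (rule bij_betw_byWitness[where f' = "\<lambda>xs. restrict ((!) xs) ?V"])
    show "\<forall>\<kappa>\<in>?L. restrict ((!) (map \<kappa> [0..<?n])) ?V = \<kappa>"
      by (auto simp: V PiE_def extensional_def restrict_def)
    show "\<forall>xs\<in>?R. map (restrict ((!) xs) ?V) [0..<?n] = xs"
      by (auto simp: V words_def intro: nth_equalityI)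
    show "(\<lambda>\<kappa>. map \<kappa> [0..<?n]) ` ?L \<subseteq> ?R"
    proof (rule image_subsetI)
      fix \<kappa> assume \<kappa>: "\<kappa> \<in> ?L"
      let ?xs = "map \<kappa> [0..<?n]"
      have nth: "?xs ! v = \<kappa> v" if "v \<in> ?V" for v using that by (simp add: V)
      have cnt: "count_list ?xs = \<alpha>"
      proof
        fix i
        have "{v\<in>?V. ?xs ! v = i} = {v\<in>?V. \<kappa> v = i}" using nth by auto
        then show "count_list ?xs i = \<alpha> i" using \<kappa> count[of ?xs i] by simp
      qed
      have "proper_word a b ?xs"
        using \<kappa> nth by (subst proper_word_iff[OF assms(1,2)]) auto
      moreover have "set ?xs \<subseteq> A"
        using cnt assms(3) by (metis count_list_0_iff subsetI)
      ultimately show "?xs \<in> ?R" using cnt by (simp add: words_def)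
    qed
    show "(\<lambda>xs. restrict ((!) xs) ?V) ` ?R \<subseteq> ?L"
    proof (rule image_subsetI)
      fix xs assume xs: "xs \<in> ?R"
      then have len: "length xs = ?n" by (simp add: words_def)
      have "{v\<in>?V. restrict ((!) xs) ?V v = i} = {v\<in>?V. xs ! v = i}" for i by auto
      then show "restrict ((!) xs) ?V \<in> ?L"
        using xs proper_word_iff[OF assms(1,2) len] count[OF len] by auto
    qed
  qed
  then show ?thesis unfolding csf_def by (simp add: bij_betw_same_card)
qed

text \<open>Together with \<open>ecoef_infinite_support\<close>, this disposes of the exponent
  vectors that are not exponents of a monomial.\<close>

lemma csf_infinite_support:
  assumes "finite V" "infinite {i. \<alpha> i \<noteq> 0}"
  shows "csf V R \<alpha> = 0"
proof -
  have False if "\<forall>i. card {v\<in>V. \<kappa> v = i} = \<alpha> i" for \<kappa>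
  proof -
    have z: "\<alpha> i = 0" if "i \<notin> \<kappa> ` V" for i
    proof -
      have "{v\<in>V. \<kappa> v = i} = {}" using that by auto
      then show ?thesis
        using \<open>\<forall>i. card {v\<in>V. \<kappa> v = i} = \<alpha> i\<close>[THEN spec, of i] by (simp only: card.empty)
    qed
    have "{i. \<alpha> i \<noteq> 0} \<subseteq> \<kappa> ` V"
    proof
      fix i assume "i \<in> {i. \<alpha> i \<noteq> 0}"
      then have "\<alpha> i \<noteq> 0" by simp
      from this z show "i \<in> \<kappa> ` V" by (rule contrapos_np)
    qed
    from finite_subset[OF this finite_imageI[OF assms(1)]] assms(2) show False by (rule notE[rotated])
  qed
  then have none: "\<not> (\<forall>i. card {v\<in>V. \<kappa> v = i} = \<alpha> i)" for \<kappa> by (rule notI)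
  show ?thesis unfolding csf_def by (simp only: none simp_thms Collect_empty_eq card.empty of_nat_0 empty_def[symmetric])
qed

lemma ecoef_infinite_support:
  assumes "infinite {i. \<alpha> i \<noteq> 0}"
  shows "ecoef K \<alpha> = 0"
proof -
  have contra: False
    if fin: "\<forall>j<length K. finite (Ss ! j) \<and> card (Ss ! j) = K ! j"
      and cnt: "\<forall>i. card {j. j < length K \<and> i \<in> Ss ! j} = \<alpha> i" for Ss :: "nat set list"
  proof -
    have z: "\<alpha> i = 0" if "i \<notin> (\<Union>j<length K. Ss ! j)" for i
    proof -
      have "{j. j < length K \<and> i \<in> Ss ! j} = {}" using that by auto
      then show ?thesis using cnt[THEN spec, of i] by (simp only: card.empty)
    qed
    have "{i. \<alpha> i \<noteq> 0} \<subseteq> (\<Union>j<length K. Ss ! j)"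
    proof
      fix i assume "i \<in> {i. \<alpha> i \<noteq> 0}"
      then have "\<alpha> i \<noteq> 0" by simp
      from this z show "i \<in> (\<Union>j<length K. Ss ! j)" by (rule contrapos_np)
    qed
    moreover have "finite (\<Union>j<length K. Ss ! j)" using fin by auto
    ultimately have "finite {i. \<alpha> i \<noteq> 0}" by (rule finite_subset)
    with assms show False by (rule notE)
  qed
  have none: "\<not> ((\<forall>j<length K. finite (Ss ! j) \<and> card (Ss ! j) = K ! j) \<and>
      (\<forall>i. card {j. j < length K \<and> i \<in> Ss ! j} = \<alpha> i))" for Ss :: "nat set list"
    by (rule notI, erule conjE) (rule contra)
  show ?thesis unfolding ecoef_def by (simp only: none simp_thms card.empty of_nat_0 empty_def[symmetric])
qed

lemma poly_mapping_of_fun: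
  assumes "finite {i. \<alpha> i \<noteq> 0}"
  obtains m :: "'i \<Rightarrow>\<^sub>0 nat" where "Poly_Mapping.lookup m = \<alpha>"
  by (rule that) (rule lookup_Abs_poly_mapping[OF assms])

text \<open>The order of the parts is invisible in the commutative polynomial ring, which saves
  permuting tuples of sets.\<close>

lemma ecoef_mset:
  assumes "mset K = mset L"
  shows "ecoef K = ecoef L"
proof
  fix \<alpha>
  show "ecoef K \<alpha> = ecoef L \<alpha>"
  proof (cases "finite {i. \<alpha> i \<noteq> 0}")
    case True
    then obtain m where m: "Poly_Mapping.lookup m = \<alpha>" by (rule poly_mapping_of_fun)
    define A where "A = {i. \<alpha> i \<noteq> 0}"
    interpret weighted_colours A indet using True by unfold_locales (simp add: A_def)
    have mA: "i \<in> A" if "Poly_Mapping.lookup m i \<noteq> 0" for i using that by (simp add: A_def m)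
    have ec: "ecoef K \<alpha> = Poly_Mapping.lookup (eprod K) m" for K
  proof -
    have "ecoef K (Poly_Mapping.lookup m) = Poly_Mapping.lookup (eprod K) m"
      by (rule ecoef_lookup[OF finite_A mA])
    then show ?thesis by (simp only: m)
  qed
    have "eprod K = eprod L"
      unfolding eprod_def using assms by (simp flip: prod_mset_prod_list)
    then show ?thesis by (simp add: ec)
  qed (simp add: ecoef_infinite_support)
qed

text \<open>With A the support of \<alpha>, the vector \<alpha> is the exponent of a monomial in the
  variables of A. Its coefficients on both sides of \<open>sum_proper_words\<close> are
  compared.\<close>

theorem csf_raw_coeff:
  assumes "1 \<le> a" "2 \<le> c"
  shows "csf (cpc_vertices a b c) (cpc_edge a b c) \<alpha>
    = fact (a - 1) * (\<Sum>K\<in>compositions (a + b + c - 1). of_int (raw_coeff a b c K) * wK K * ecoef K \<alpha>)"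
proof (cases "finite {i. \<alpha> i \<noteq> 0}")
  case True
  then obtain m where m: "Poly_Mapping.lookup m = \<alpha>" by (rule poly_mapping_of_fun)
  define A where "A = {i. \<alpha> i \<noteq> 0}"
  interpret weighted_colours A indet using True by unfold_locales (simp add: A_def)
  let ?n = "a + b + c - 1"
  have mA: "i \<in> A" if "Poly_Mapping.lookup m i \<noteq> 0" for i using that by (simp add: A_def m)
  have ec: "Poly_Mapping.lookup (eprod K) m = ecoef K \<alpha>" for K
  proof -
    have "ecoef K (Poly_Mapping.lookup m) = Poly_Mapping.lookup (eprod K) m"
      by (rule ecoef_lookup[OF finite_A mA])
    then show ?thesis by (simp only: m)
  qed
  have "{xs\<in>words A ?n. proper_word a b xs \<and> count_list xs = \<alpha>}
     = {xs\<in>words A ?n. proper_word a b xs \<and> (\<Sum>i\<leftarrow>xs. Poly_Mapping.single i (Suc 0)) = m}"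
    unfolding m[symmetric] by (simp add: poly_mapping_eq_iff lookup_sum_list_single fun_eq_iff)
  moreover have "csf (cpc_vertices a b c) (cpc_edge a b c) \<alpha>
     = real (card {xs\<in>words A ?n. proper_word a b xs \<and> count_list xs = \<alpha>})"
    by (rule csf_words[OF assms]) (simp add: A_def)
  ultimately have "csf (cpc_vertices a b c) (cpc_edge a b c) \<alpha>
     = Poly_Mapping.lookup (\<Sum>xs\<in>words A ?n. of_bool (proper_word a b xs) * wt xs) m"
    unfolding wt_def prod_list_monom by (simp only: lookup_sum_monom[OF finite_words[OF finite_A]])
  also have "\<dots> = of_nat (fact (a - 1)) *
      (\<Sum>K\<in>compositions ?n. of_int (raw_coeff a b c K) * (wK K * ecoef K \<alpha>))"
    by (simp only: sum_proper_words[OF assms] lookup_of_nat_mult lookup_sum lookup_of_int_mult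
        wE_eprod ec wK_of_int)
  finally show ?thesis by (simp add: mult.assoc)
next
  case False
  then show ?thesis
    by (simp add: csf_infinite_support ecoef_infinite_support cpc_vertices_def)
qed

section \<open>From raw coefficients to c_K\<close>

lemma sigmaK_obtain:
  assumes "t \<le> sum_list K"
  obtains j where "j \<le> length K" "sigmaK K t = sum_list (take j K)" "t \<le> sum_list (take j K)"
    "\<And>r. r \<le> length K \<Longrightarrow> t \<le> sum_list (take r K) \<Longrightarrow> sum_list (take j K) \<le> sum_list (take r K)"
proof -
  let ?M = "{sum_list (take j K) | j. j \<le> length K \<and> t \<le> sum_list (take j K)}"
  have fin: "finite ?M" by simp
  have "?M \<noteq> {}" using assms by (auto intro: exI[of _ "length K"])
  with fin have "Min ?M \<in> ?M" by (rule Min_in)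
  then obtain j where "j \<le> length K" "Min ?M = sum_list (take j K)" "t \<le> sum_list (take j K)"
    by auto
  moreover have "Min ?M \<le> sum_list (take r K)" if "r \<le> length K" "t \<le> sum_list (take r K)" for r
    using fin that by (intro Min_le) auto
  ultimately show ?thesis using that[of j] by (simp add: sigmaK_def)
qed

lemma sum_list_take_Suc: "r < length K \<Longrightarrow> sum_list (take (Suc r) K) = sum_list (take r K) + K ! r"
  for K :: "nat list"
  by (simp add: take_Suc_conv_app_nth)

lemma sum_list_take_less:
  fixes K :: "nat list"
  assumes "\<forall>k\<in>set K. 0 < k" "i < j" "j \<le> length K"
  shows "sum_list (take i K) < sum_list (take j K)"
  using assms(2,3)
proof (induction j)
  case (Suc j)
  have "0 < K ! j" using assms(1) Suc.prems by simp
  then show ?case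
    using Suc by (cases "i = j") (auto simp: sum_list_take_Suc)
qed simp

text \<open>Parts are positive, so partial sums increase strictly and the condition holds exactly
  from the position j attaining \<open>sigmaK\<close> on; the parts from there on telescope.\<close>

lemma sum_after_sigmaK:
  assumes K: "K \<in> compositions n" and t: "t \<le> n"
  shows "(\<Sum>r<length K. of_bool (t \<le> sum_list (take r K)) * int (K ! r)) = int n - int (sigmaK K t)"
proof -
  have pos: "\<forall>k\<in>set K. 0 < k" and n: "sum_list K = n" using K by (auto simp: compositions_def)
  obtain j where j: "j \<le> length K" "sigmaK K t = sum_list (take j K)" "t \<le> sum_list (take j K)"
    "\<And>r. r \<le> length K \<Longrightarrow> t \<le> sum_list (take r K) \<Longrightarrow> sum_list (take j K) \<le> sum_list (take r K)"
    using sigmaK_obtain[of t K] t n by auto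
  have iff: "t \<le> sum_list (take r K) \<longleftrightarrow> j \<le> r" if "r < length K" for r
  proof
    assume "t \<le> sum_list (take r K)"
    then show "j \<le> r" using j(4)[of r] that sum_list_take_less[OF pos, of r j] j(1) by linarith
  next
    assume "j \<le> r"
    then show "t \<le> sum_list (take r K)"
      using j(3) sum_list_take_less[OF pos, of j r] that by (cases "j = r") auto
  qed
  have "(\<Sum>r<length K. of_bool (t \<le> sum_list (take r K)) * int (K ! r)) = (\<Sum>r=j..<length K. int (K ! r))"
    by (rule sum.mono_neutral_cong_right) (auto simp: iff)
  also have "\<dots> = (\<Sum>r=j..<length K. int (sum_list (take (Suc r) K)) - int (sum_list (take r K)))"
    by (intro sum.cong refl) (simp add: sum_list_take_Suc)
  also have "\<dots> = int n - int (sigmaK K t)"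
    using j(1,2) n by (subst sum_Suc_diff') auto
  finally show ?thesis .
qed

text \<open>If K is admissible, so is every prefix, and c - 1 - (n - sigma) = sigma - (a + b)
  because n = a + b + c - 1.\<close>

lemma raw_coeff_eq:
  assumes "1 \<le> a" "2 \<le> c" and K: "K \<in> compositions (a + b + c - 1)"
  shows "real_of_int (raw_coeff a b c K)
    = of_bool (admissible a K) * ThetaK K (a + b) - of_bool (\<not> admissible a K \<and> a + b \<le> K ! 0) * real (K ! 1)"
proof (cases "admissible a K")
  case True
  then have "admissible a (take r K)" for r by (auto simp: admissible_def)
  then have "raw_coeff a b c K = int (c - 1) - (\<Sum>r<length K. of_bool (a + b \<le> sum_list (take r K)) * int (K ! r))"
    using True by (simp add: raw_coeff_def)
  also have "\<dots> = int (sigmaK K (a + b)) - int (a + b)"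
    using assms by (subst sum_after_sigmaK[OF K]) auto
  finally show ?thesis using True by (simp add: ThetaK_def)
next
  case False
  then obtain p q ks where Kpq: "K = p # q # ks" "q < a"
    by (auto simp: admissible_def Suc_le_length_iff numeral_2_eq_2)
  \<comment> \<open>As k_2 < a, a prefix is admissible only for r <= 1, and r = 0 fails because its
    sum 0 is below a + b.\<close>
  have "(\<Sum>r<length K. of_bool (a + b \<le> sum_list (take r K) \<and> admissible a (take r K)) * int (K ! r))
     = (\<Sum>r\<in>{1::nat}. of_bool (a + b \<le> K ! 0) * int (K ! 1))"
  proof (rule sum.mono_neutral_cong_right)
    show "\<forall>r\<in>{..<length K} - {1}. of_bool (a + b \<le> sum_list (take r K) \<and> admissible a (take r K)) * int (K ! r) = 0"
    proof
      fix r assume "r \<in> {..<length K} - {1}"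
      then consider "r = 0" | s where "r = Suc (Suc s)" by (cases r; cases "r - 1") auto
      then show "of_bool (a + b \<le> sum_list (take r K) \<and> admissible a (take r K)) * int (K ! r) = 0"
        using Kpq assms(1) by cases (auto simp: admissible_def)
    qed
  qed (auto simp: Kpq admissible_def)
  then show ?thesis using False by (simp add: raw_coeff_def)
qed

lemma sigmaK_Cons2:
  assumes "p < t" "0 < t" "t \<le> p + q"
  shows "sigmaK (p # q # ks) t = p + q"
  unfolding sigmaK_def
proof (rule Min_eqI)
  fix y assume "y \<in> {sum_list (take j (p # q # ks)) | j. j \<le> length (p # q # ks) \<and> t \<le> sum_list (take j (p # q # ks))}"
  then obtain j where "y = sum_list (take j (p # q # ks))" "t \<le> sum_list (take j (p # q # ks))" by auto
  then show "p + q \<le> y" using assms by (cases j; cases "j - 1") auto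
qed (use assms in \<open>auto intro!: exI[of _ 2]\<close>)

lemma wK_nonneg: "K \<in> compositions n \<Longrightarrow> 0 \<le> wK K"
  by (auto simp: wK_def compositions_def split: list.split intro!: mult_nonneg_nonneg prod_list_nonneg)
     (metis Suc_leI of_nat_1 of_nat_le_iff One_nat_def)

lemma cK_nonneg:
  assumes "1 \<le> a" "2 \<le> c" and K: "K \<in> compositions (a + b + c - 1)"
  shows "0 \<le> cK a b K"
proof -
  have "a + b \<le> sum_list K" using assms by (auto simp: compositions_def)
  then have "0 \<le> ThetaK K (a + b)"
    by (rule sigmaK_obtain) (simp add: ThetaK_def)
  moreover have "0 \<le> real (K ! 1) - real a - real b + (real (K ! 1) - real (K ! 0)) / (real (K ! 1) - 1)"
    if "K ! 0 \<le> a - 1" "a + b \<le> K ! 1"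
  proof -
    have "0 \<le> (real (K ! 1) - real (K ! 0)) / (real (K ! 1) - 1)"
      using that assms by (intro divide_nonneg_nonneg) auto
    then show ?thesis using that by linarith
  qed
  ultimately show ?thesis by (simp add: cK_def)
qed

lemma sum_raw_coeff_cK:
  fixes a b c :: nat
  assumes "1 \<le> a" "2 \<le> c"
  defines "n \<equiv> a + b + c - 1"
  shows "(\<Sum>K\<in>compositions n. of_int (raw_coeff a b c K) * wK K * ecoef K \<alpha>)
    = (\<Sum>K\<in>compositions n. cK a b K * wK K * ecoef K \<alpha>)"
proof -
  let ?C = "compositions n"
  let ?f = "\<lambda>K. wK K * ecoef K \<alpha>"
  let ?B = "{K\<in>?C. 2 \<le> length K \<and> K ! 0 \<le> a - 1 \<and> a + b \<le> K ! 1}"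
  let ?B' = "{K\<in>?C. 2 \<le> length K \<and> K ! 1 < a \<and> a + b \<le> K ! 0}"
  let ?T = "\<Sum>K\<in>?C. of_bool (admissible a K) * ThetaK K (a + b) * ?f K"
  \<comment> \<open>For K in \<open>?B\<close> the swapped composition carries k_1 times its weight
    k_2 (k_1 - 1), up to the common later factors; dividing by k_1 (k_2 - 1) expresses this as a
    multiple of w_K.\<close>
  let ?g = "\<lambda>K. real (K ! 1) * (real (K ! 0) - 1) / (real (K ! 1) - 1)"
  let ?s = "\<lambda>K. K ! 1 # K ! 0 # drop 2 K"
  have "(\<Sum>K\<in>?C. of_int (raw_coeff a b c K) * wK K * ecoef K \<alpha>)
      = ?T - (\<Sum>K\<in>?C. of_bool (\<not> admissible a K \<and> a + b \<le> K ! 0) * real (K ! 1) * ?f K)"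
    unfolding sum_subtractf[symmetric]
    by (intro sum.cong refl)
       (simp only: raw_coeff_eq[OF assms(1,2)] n_def left_diff_distrib mult.assoc)
  also have "(\<Sum>K\<in>?C. of_bool (\<not> admissible a K \<and> a + b \<le> K ! 0) * real (K ! 1) * ?f K)
      = (\<Sum>K\<in>?B'. real (K ! 1) * ?f K)"
    by (rule sum.mono_neutral_cong_right) (auto simp: finite_compositions admissible_def)
  also have "\<dots> = (\<Sum>K\<in>?B. ?g K * ?f K)"
  proof (rule sum.reindex_bij_witness[of _ ?s ?s])
    have split: "\<exists>p q ks. K = p # q # ks" if "2 \<le> length K" for K :: "nat list"
      using that by (auto simp: Suc_le_length_iff numeral_2_eq_2)
    fix K assume K: "K \<in> ?B'"
    then obtain p q ks where Kpq: "K = p # q # ks" using split by blast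
    show "?s (?s K) = K" "?s K \<in> ?B" using K by (auto simp: Kpq compositions_def)
    have "mset (q # p # ks) = mset (p # q # ks)" by simp
    then have ec: "ecoef (q # p # ks) = ecoef (p # q # ks)" by (rule ecoef_mset)
    \<comment> \<open>Indeed p >= a + b > q >= 1, so the denominator p - 1 in \<open>?g\<close> is
      nonzero.\<close>
    have "2 \<le> p" using K by (auto simp: Kpq compositions_def)
    then show "?g (?s K) * ?f (?s K) = real (K ! 1) * ?f K"
      by (simp add: Kpq ec wK_def field_simps)
  next
    have split: "\<exists>p q ks. K = p # q # ks" if "2 \<le> length K" for K :: "nat list"
      using that by (auto simp: Suc_le_length_iff numeral_2_eq_2)
    fix K assume K: "K \<in> ?B"
    then obtain p q ks where Kpq: "K = p # q # ks" using split by blast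
    show "?s (?s K) = K" "?s K \<in> ?B'" using K assms(1) by (auto simp: Kpq compositions_def)
  qed
  also have "(\<Sum>K\<in>?B. ?g K * ?f K) = (\<Sum>K\<in>?C. of_bool (K \<in> ?B) * ?g K * ?f K)"
    by (rule sum.mono_neutral_cong_left) (auto simp: finite_compositions)
  also have "?T - \<dots> = (\<Sum>K\<in>?C. cK a b K * wK K * ecoef K \<alpha>)"
    unfolding sum_subtractf[symmetric]
  proof (rule sum.cong[OF refl])
    fix K assume K: "K \<in> ?C"
    have "of_bool (admissible a K) * ThetaK K (a + b) - of_bool (K \<in> ?B) * ?g K = cK a b K"
    proof (cases "K \<in> ?B")
      case True
      then obtain p q ks where Kpq: "K = p # q # ks"
        by (auto simp: Suc_le_length_iff numeral_2_eq_2)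
      have pq: "1 \<le> p" "p \<le> a - 1" "a + b \<le> q" using True by (auto simp: Kpq compositions_def)
      then have "2 \<le> q" by linarith
      \<comment> \<open>Theta is then p + q - a - b, and p - q (p - 1) / (q - 1) = (q - p) / (q - 1)
        yields the fraction in \<open>cK\<close>.\<close>
      have "sigmaK K (a + b) = p + q"
        unfolding Kpq by (rule sigmaK_Cons2) (use pq assms(1) in auto)
      with True pq \<open>2 \<le> q\<close> show ?thesis
        by (simp add: cK_def ThetaK_def admissible_def Kpq field_simps)
    next
      case False
      with K show ?thesis by (auto simp: cK_def admissible_def)
    qed
    then have "cK a b K * ?f K = (of_bool (admissible a K) * ThetaK K (a + b) - of_bool (K \<in> ?B) * ?g K) * ?f K"
      by (rule arg_cong[OF sym])
    then show "of_bool (admissible a K) * ThetaK K (a + b) * ?f K - of_bool (K \<in> ?B) * ?g K * ?f K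
        = cK a b K * wK K * ecoef K \<alpha>"
      by (simp only: left_diff_distrib mult.assoc)
  qed
  finally show ?thesis .
qed

section \<open>Positivity in the e-basis\<close>

lemma e_positive_compositions:
  assumes "\<And>K. K \<in> compositions n \<Longrightarrow> 0 \<le> g K"
  shows "e_positive (\<lambda>\<alpha>. \<Sum>K\<in>compositions n. g K * ecoef K \<alpha>)"
proof -
  \<comment> \<open>Compositions with the same decreasing rearrangement share \<open>ecoef\<close>,
    so each partition collects a sum of nonnegative coefficients.\<close>
  let ?p = "\<lambda>K :: nat list. rev (sort K)"
  let ?d = "\<lambda>p. \<Sum>K | K \<in> compositions n \<and> ?p K = p. g K"
  have "(\<Sum>K\<in>compositions n. g K * ecoef K \<alpha>) = (\<Sum>p\<in>?p ` compositions n. ?d p * ecoef p \<alpha>)" for \<alpha>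
  proof -
    have "(\<Sum>K\<in>compositions n. g K * ecoef K \<alpha>)
       = (\<Sum>p\<in>?p ` compositions n. \<Sum>K | K \<in> compositions n \<and> ?p K = p. g K * ecoef K \<alpha>)"
      by (rule sum.image_gen) (rule finite_compositions)
    also have "\<dots> = (\<Sum>p\<in>?p ` compositions n. ?d p * ecoef p \<alpha>)"
      unfolding sum_distrib_right
    proof (intro sum.cong refl)
      fix p K assume "K \<in> {K \<in> compositions n. ?p K = p}"
      then have "mset K = mset p" by auto
      then have "ecoef K = ecoef p" by (rule ecoef_mset)
      then show "g K * ecoef K \<alpha> = g K * ecoef p \<alpha>" by simp
    qed
    finally show ?thesis .
  qed
  then have "(\<lambda>\<alpha>. \<Sum>K\<in>compositions n. g K * ecoef K \<alpha>)
      = (\<lambda>\<alpha>. \<Sum>p\<in>?p ` compositions n. ?d p * ecoef p \<alpha>)"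
    by (rule ext)
  moreover have "\<forall>p\<in>?p ` compositions n. is_partition p \<and> 0 \<le> ?d p"
  proof (intro ballI conjI)
    fix p assume "p \<in> ?p ` compositions n"
    then show "is_partition p" by (auto simp: is_partition_def compositions_def)
    show "0 \<le> ?d p" by (rule sum_nonneg) (simp add: assms)
  qed
  moreover have "finite (?p ` compositions n)"
    by (intro finite_imageI finite_compositions)
  ultimately show ?thesis
    unfolding e_positive_def by (intro exI[of _ "?p ` compositions n"] exI[of _ ?d] conjI)
qed

theorem theorem3p3:
  fixes a b c :: nat
  assumes "1 \<le> a" and "2 \<le> c"
  defines "n \<equiv> a + b + c - 1"
  shows "csf (cpc_vertices a b c) (cpc_edge a b c) =
           (\<lambda>\<alpha>. fact (a - 1) * (\<Sum>K\<in>compositions n. cK a b K * wK K * ecoef K \<alpha>))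
         \<and> (\<forall>K\<in>compositions n. 0 \<le> fact (a - 1) * cK a b K * wK K)
         \<and> e_positive (csf (cpc_vertices a b c) (cpc_edge a b c))"
proof -
  have csf: "csf (cpc_vertices a b c) (cpc_edge a b c) =
      (\<lambda>\<alpha>. fact (a - 1) * (\<Sum>K\<in>compositions n. cK a b K * wK K * ecoef K \<alpha>))"
    unfolding n_def using csf_raw_coeff[OF assms(1,2)] sum_raw_coeff_cK[OF assms(1,2)] by (intro ext) simp
  have nonneg: "\<forall>K\<in>compositions n. 0 \<le> fact (a - 1) * cK a b K * wK K"
    unfolding n_def using cK_nonneg[OF assms(1,2)] wK_nonneg by simp
  have "e_positive (\<lambda>\<alpha>. \<Sum>K\<in>compositions n. (fact (a - 1) * cK a b K * wK K) * ecoef K \<alpha>)"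
    using nonneg by (intro e_positive_compositions) auto
  then have "e_positive (csf (cpc_vertices a b c) (cpc_edge a b c))"
    unfolding csf by (simp add: sum_distrib_left mult.assoc)
  with csf nonneg show ?thesis by blast
qed

end
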